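(* Let $m\ge 1$ be an integer, let $a_0,\dots,a_m\in C^\infty([0,1])$ be real-valued, and let $S(x,t)=\sum_{i=0}^m a_i(t)x^i$. Assume that there exist $m$ real numbers $\lambda_1<\cdots<\lambda_m$ such that either $$(-1)^i S(\lambda_i,t)\ge 0\quad\text{for all } t\in[0,1] \text{ and all } i=1,\dots,m,$$ or $$(-1)^i S(\lambda_i,t)\le 0\quad\text{for all } t\in[0,1] \text{ and all } i=1,\dots,m.$$ Then the differential equation $\dot x=S(x,t)$ has at most $m$ isolated periodic solutions, counted with multiplicities. This upper bound is sharp, i.e. for every $m\geq 1$ there is an equation $\dot x=S(x,t)$ with $S(x,t)=\sum_{i=0}^m a_i(t)x^i$, $a_0,\dots,a_m\in C^\infty([0,1])$ real-valued, for which there exist $m$ real numbers $\lambda_1<\cdots<\lambda_m$ such that either $(-1)^i S(\lambda_i,t)\ge 0$ for all $t\in[0,1]$ and all $i=1,\dots,m$, or $(-1)^i S(\lambda_i,t)\le 0$ for all $t\in[0,1]$ and all $i=1,\dots,m$, and having exactly $m$ isolated periodic solutions, counted with multiplicities.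
   Context: The equation is $\dot x=\frac{dx}{dt}=S(x,t)$ with $x\in\mathbb R$, $t\in[0,1]$. A solution $x(t)$ is called a periodic solution if it is defined on all of $[0,1]$ and $x(0)=x(1)$. Let $x(t,x_0)$ denote the solution with $x(0,x_0)=x_0$, and let $H(x_0)=x(1,x_0)$ be the return map, defined for those $x_0$ whose solution exists on $[0,1]$. Periodic solutions correspond to zeros of $H(x_0)-x_0$; a periodic solution $x(t,x_0)$ is isolated if $x_0$ is an isolated zero of $H(\cdot)-\mathrm{id}$, and its multiplicity is the order of that zero. *)

theory Defs
  imports "HOL-Analysis.Analysis" "HOL-Library.Extended_Nat"
begin

text \<open>Membership in \<open>C\<^sup>\<infinity>([0,1])\<close>: \<open>D n\<close> is the \<open>n\<close>-th derivative on the closed interval,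
  one-sided at the end points. The values of \<open>f\<close> outside \<open>[0,1]\<close> are irrelevant.\<close>

definition smooth_on_unit :: "(real \<Rightarrow> real) \<Rightarrow> bool" where
  "smooth_on_unit f \<longleftrightarrow>
     (\<exists>D :: nat \<Rightarrow> real \<Rightarrow> real. (\<forall>t\<in>{0..1}. D 0 t = f t) \<and>
        (\<forall>n. \<forall>t\<in>{0..1}. (D n has_real_derivative D (Suc n) t) (at t within {0..1})))"

definition poly_field :: "nat \<Rightarrow> (nat \<Rightarrow> real \<Rightarrow> real) \<Rightarrow> real \<Rightarrow> real \<Rightarrow> real" where
  "poly_field m a x t = (\<Sum>i\<le>m. a i t * x ^ i)"

definition alternating_lines :: "nat \<Rightarrow> (real \<Rightarrow> real \<Rightarrow> real) \<Rightarrow> bool" where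
  "alternating_lines m S \<longleftrightarrow>
     (\<exists>l :: nat \<Rightarrow> real. strict_mono_on {1..m} l \<and>
        ((\<forall>t\<in>{0..1}. \<forall>i\<in>{1..m}. (-1) ^ i * S (l i) t \<ge> 0) \<or>
         (\<forall>t\<in>{0..1}. \<forall>i\<in>{1..m}. (-1) ^ i * S (l i) t \<le> 0)))"

definition solves :: "(real \<Rightarrow> real \<Rightarrow> real) \<Rightarrow> (real \<Rightarrow> real) \<Rightarrow> bool" where
  "solves S x \<longleftrightarrow>
     (\<forall>t\<in>{0..1}. (x has_real_derivative S (x t) t) (at t within {0..1}))"

text \<open>The return map is partial: \<open>return_map S\<close> is meaningful only on \<open>return_dom S\<close>, the set of
  initial values whose solution exists on all of \<open>[0,1]\<close>. For the polynomial equations considered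
  here solutions of the initial value problem are unique, so the description is well defined.\<close>

definition return_dom :: "(real \<Rightarrow> real \<Rightarrow> real) \<Rightarrow> real set" where
  "return_dom S = {x0. \<exists>x. solves S x \<and> x 0 = x0}"

definition return_map :: "(real \<Rightarrow> real \<Rightarrow> real) \<Rightarrow> real \<Rightarrow> real" where
  "return_map S x0 = (THE y. \<exists>x. solves S x \<and> x 0 = x0 \<and> x 1 = y)"

text \<open>Periodic solutions are represented by their initial values, i.e. by the zeros of
  \<open>H - id\<close>; by uniqueness of solutions this is a bijective correspondence.\<close>

definition periodic_values :: "(real \<Rightarrow> real \<Rightarrow> real) \<Rightarrow> real set" where
  "periodic_values S = {x0 \<in> return_dom S. return_map S x0 - x0 = 0}"

definition isolated_periodic_values :: "(real \<Rightarrow> real \<Rightarrow> real) \<Rightarrow> real set" where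
  "isolated_periodic_values S = {x0. x0 isolated_in periodic_values S}"

text \<open>Order of the first non-vanishing derivative; it is \<open>\<infinity>\<close> (the infimum of the empty set) if all
  derivatives vanish. It is applied below to \<open>H - id\<close>, which is smooth on the open set
  \<open>return_dom S\<close>, so that its iterated derivatives at points of that set are the genuine ones.\<close>

definition order_of_zero :: "(real \<Rightarrow> real) \<Rightarrow> real \<Rightarrow> enat" where
  "order_of_zero f x0 = Inf (enat ` {k. (deriv ^^ k) f x0 \<noteq> 0})"

definition multiplicity_at :: "(real \<Rightarrow> real \<Rightarrow> real) \<Rightarrow> real \<Rightarrow> enat" where
  "multiplicity_at S x0 = order_of_zero (\<lambda>y. return_map S y - y) x0"

end

theory Submission
  imports Defs "HOL-Computational_Algebra.Polynomial"
begin

text \<open>Write \<open>P x = \<Prod>\<^sub>\<nu> (x - \<nu>)\<close> over the given lines. By Lagrange interpolation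
  \<open>S = P R\<close> with \<open>R x t = a\<^sub>m t + \<Sum>\<^sub>\<nu> c\<^sub>\<nu> t / (x - \<nu>)\<close>, and alternation means that all \<open>c\<^sub>\<nu>\<close>
  have one common weak sign, so \<open>R\<close> is monotone in \<open>x\<close> between consecutive poles. Let \<open>A\<close> be the
  set of lines with \<open>c\<^sub>\<nu>\<close> not identically zero; no periodic orbit meets them, and the other lines are
  themselves periodic orbits. A periodic orbit off the lines satisfies \<open>\<integral> R = 0\<close> (integrate
  \<open>x' / P x\<close>) and is simple; a periodic line has multiplicity 1, or 2 if \<open>\<integral> R = 0\<close> along it. Hence the
  sum of multiplicities is at most \<open>m - card A\<close> plus the number of periodic orbits with \<open>\<integral> R = 0\<close>.
  Monotonicity of \<open>R\<close> allows at most one of these in each of the \<open>card A + 1\<close> gaps of \<open>A\<close>, and not in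
  both unbounded gaps, since there \<open>\<integral> R\<close> exceeds resp. is less than \<open>\<integral> a\<^sub>m\<close>. If \<open>A\<close> is empty and
  \<open>\<integral> a\<^sub>m = 0\<close>, every solution is periodic and none is isolated.\<close>

section \<open>First-order linear equations on the unit interval\<close>

lemma nonneg_deriv_imp_mono:
  fixes f f' :: "real \<Rightarrow> real"
  assumes d: "\<And>t. t \<in> {0..1} \<Longrightarrow> (f has_real_derivative f' t) (at t within {0..1})"
    and nn: "\<And>t. t \<in> {0..1} \<Longrightarrow> 0 \<le> f' t"
    and "0 \<le> s" "s \<le> t" "t \<le> 1"
  shows "f s \<le> f t"
proof -
  have "\<exists>x\<in>{s..t}. f t - f s = (\<lambda>h. f' x * h) (t - s)"
  proof (rule mvt_very_simple)
    fix x assume x: "s \<le> x" "x \<le> t"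
    have "(f has_real_derivative f' x) (at x within {s..t})"
      by (rule has_field_derivative_subset[OF d]) (use x assms in auto)
    then show "(f has_derivative (\<lambda>h. f' x * h)) (at x within {s..t})"
      by (simp add: has_field_derivative_def)
  qed fact
  then obtain x where x: "x \<in> {s..t}" "f t - f s = f' x * (t - s)" by auto
  moreover have "0 \<le> f' x * (t - s)"
    using x nn[of x] assms by (intro mult_nonneg_nonneg) auto
  ultimately show ?thesis by linarith
qed

text \<open>Applied with \<open>r = 0\<close> to the gap between two solutions, and with
  \<open>r\<close> the field on a line to the distance of a solution from that line.\<close>

lemma integrating_factor:
  assumes "continuous_on {0..1} q" "t \<in> {0..1}"
    and w: "(w has_real_derivative q t * w t + r) (at t within {0..1})"
  shows "((\<lambda>t. w t * exp (- integral {0..t} q)) has_real_derivative r * exp (- integral {0..t} q))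
    (at t within {0..1})"
  using integral_has_real_derivative[OF assms(1,2)] w
  by (auto intro!: derivative_eq_intros simp: algebra_simps)

lemma integral_unit_pos:
  fixes f :: "real \<Rightarrow> real"
  assumes "continuous_on {0..1} f" and nn: "\<And>t. t \<in> {0..1} \<Longrightarrow> 0 \<le> f t"
    and "t0 \<in> {0..1}" "f t0 \<noteq> 0"
  shows "0 < integral {0..1} f"
proof -
  have "0 \<le> integral {0..1} f"
    using nn by (intro integral_nonneg integrable_continuous_real assms(1)) auto
  moreover have "integral {0..1} f \<noteq> 0"
    using integral_eq_0_iff[OF assms(1)] nn assms(3,4) by auto
  ultimately show ?thesis by simp
qed

lemma ftc_unit:
  assumes "\<And>t. t \<in> {0..1} \<Longrightarrow> (F has_real_derivative f t) (at t within {0..1})"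
  shows "integral {0..1} f = F 1 - F (0::real)"
  using fundamental_theorem_of_calculus[of 0 1 F f] assms
  by (auto simp: has_real_derivative_iff_has_vector_derivative intro!: integral_unique)

section \<open>Polynomial equations: uniqueness and comparison of solutions\<close>

text \<open>The quotient of \<open>S y t - S x t\<close> by \<open>y - x\<close>, written as a
  polynomial so that it is also continuous at \<open>y = x\<close>, where it is the x-derivative of
  the field.\<close>

definition diff_quot :: "nat \<Rightarrow> (nat \<Rightarrow> real \<Rightarrow> real) \<Rightarrow> real \<Rightarrow> real \<Rightarrow> real \<Rightarrow> real" where
  "diff_quot m a y x t = (\<Sum>i\<le>m. a i t * (\<Sum>j<i. x ^ (i - Suc j) * y ^ j))"

lemma poly_field_diff: "poly_field m a y t - poly_field m a x t = (y - x) * diff_quot m a y x t"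
proof -
  have "a i t * y ^ i - a i t * x ^ i = (y - x) * (a i t * (\<Sum>j<i. x ^ (i - Suc j) * y ^ j))" for i
    unfolding right_diff_distrib[symmetric] power_diff_sumr2 by (simp add: mult.left_commute)
  then show ?thesis
    unfolding poly_field_def diff_quot_def sum_distrib_left sum_subtractf[symmetric]
    by (intro sum.cong) (auto simp: sum_distrib_left)
qed

lemma solves_continuous: "solves S x \<Longrightarrow> continuous_on {0..1} x"
  unfolding solves_def by (meson DERIV_continuous continuous_on_eq_continuous_within)

locale poly_ode =
  fixes m :: nat and a :: "nat \<Rightarrow> real \<Rightarrow> real"
  assumes cont_coeff: "\<And>i. i \<le> m \<Longrightarrow> continuous_on {0..1} (a i)"
begin

abbreviation "S \<equiv> poly_field m a"
abbreviation "Q \<equiv> diff_quot m a"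

lemma continuous_on_coeff_comp:
  "i \<le> m \<Longrightarrow> continuous_on D h \<Longrightarrow> h ` D \<subseteq> {0..1} \<Longrightarrow> continuous_on D (\<lambda>z. a i (h z))"
  by (rule continuous_on_compose2[OF cont_coeff])

lemma continuous_on_field:
  assumes "continuous_on D f" "continuous_on D h" "h ` D \<subseteq> {0..1}"
  shows "continuous_on D (\<lambda>z. S (f z) (h z))"
  unfolding poly_field_def
  by (intro continuous_intros continuous_on_coeff_comp assms) auto

lemma continuous_on_diff_quot:
  assumes "continuous_on D f" "continuous_on D g" "continuous_on D h" "h ` D \<subseteq> {0..1}"
  shows "continuous_on D (\<lambda>z. Q (f z) (g z) (h z))"
  unfolding diff_quot_def
  by (intro continuous_intros continuous_on_coeff_comp assms) auto

lemma continuous_on_diff_quot_solutions: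
  assumes "solves S x" "solves S y"
  shows "continuous_on {0..1} (\<lambda>s. Q (y s) (x s) s)"
  by (intro continuous_on_diff_quot solves_continuous[OF assms(1)] solves_continuous[OF assms(2)]
      continuous_on_id) auto

lemma diff_quot_bounded: "\<exists>L\<ge>0. \<forall>x y. \<forall>t\<in>{0..1}. \<bar>x\<bar> \<le> M \<longrightarrow> \<bar>y\<bar> \<le> M \<longrightarrow> \<bar>Q y x t\<bar> \<le> L"
proof -
  let ?K = "{-M..M} \<times> {-M..M} \<times> {0..1::real}"
  have "continuous_on ?K (\<lambda>z. Q (fst z) (fst (snd z)) (snd (snd z)))"
    by (intro continuous_on_diff_quot continuous_intros) auto
  moreover have "compact ?K" by (intro compact_Times) auto
  ultimately have "bounded ((\<lambda>z. Q (fst z) (fst (snd z)) (snd (snd z))) ` ?K)"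
    using compact_continuous_image compact_imp_bounded by blast
  then obtain L where "L > 0"
    and L': "\<forall>q \<in> (\<lambda>z. Q (fst z) (fst (snd z)) (snd (snd z))) ` ?K. \<bar>q\<bar> \<le> L"
    unfolding bounded_pos real_norm_def by blast
  have L: "\<bar>Q (fst z) (fst (snd z)) (snd (snd z))\<bar> \<le> L" if "z \<in> ?K" for z
    by (rule bspec[OF L']) (rule imageI[OF that])
  have "\<bar>Q y x t\<bar> \<le> L" if "t \<in> {0..1}" "\<bar>x\<bar> \<le> M" "\<bar>y\<bar> \<le> M" for x y t
    using L[of "(y, x, t)"] that by (auto simp: abs_le_iff)
  then show ?thesis using \<open>L > 0\<close> by (intro exI[of _ L]) auto
qed

text \<open>The gap solves the linear equation \<open>w' = Q w\<close>. Uniqueness, preservation of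
  order and the derivatives of the return map are all read off from this exact formula.\<close>

lemma solution_diff:
  assumes x: "solves S x" and y: "solves S y" and t: "t \<in> {0..1}"
  shows "y t - x t = (y 0 - x 0) * exp (integral {0..t} (\<lambda>s. Q (y s) (x s) s))"
proof -
  let ?q = "\<lambda>s. Q (y s) (x s) s"
  let ?f = "\<lambda>t. (y t - x t) * exp (- integral {0..t} ?q)"
  have "(?f has_real_derivative 0) (at s within {0..1})" if s: "s \<in> {0..1}" for s
  proof -
    have "((\<lambda>t. y t - x t) has_real_derivative ?q s * (y s - x s) + 0) (at s within {0..1})"
      using x y s poly_field_diff[of m a "y s" s "x s"] unfolding solves_def
      by (auto intro!: derivative_eq_intros simp: mult.commute)
    from integrating_factor[OF continuous_on_diff_quot_solutions[OF x y] s this] show ?thesis by simp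
  qed
  then obtain c where c: "\<forall>s\<in>{0..1}. ?f s = c"
    using has_field_derivative_zero_constant[of "{0..1}" ?f] by auto
  have "?f t = ?f 0" using bspec[OF c t] bspec[OF c, of 0] by simp
  then show ?thesis by (simp add: exp_minus field_simps)
qed

lemma solution_unique:
  assumes "solves S x" "solves S y" "y 0 = x 0" "t \<in> {0..1}"
  shows "y t = x t"
  using solution_diff[OF assms(1,2,4)] assms(3) by simp

lemma solution_less:
  assumes "solves S x" "solves S y" "x 0 < y 0" "t \<in> {0..1}"
  shows "x t < y t"
  using solution_diff[OF assms(1,2,4)] assms(3) by (smt (verit) exp_gt_zero zero_less_mult_iff)

lemma return_map_eq:
  assumes "solves S x"
  shows "return_map S (x 0) = x 1"
  unfolding return_map_def
proof (rule the_equality)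
  fix y assume "\<exists>z. solves S z \<and> z 0 = x 0 \<and> z 1 = y"
  then show "y = x 1" using solution_unique[OF assms, of _ 1] by auto
qed (use assms in blast)

lemma solves_return_dom: "solves S x \<Longrightarrow> x 0 \<in> return_dom S"
  unfolding return_dom_def by auto

lemma periodic_iff: "p \<in> periodic_values S \<longleftrightarrow> (\<exists>x. solves S x \<and> x 0 = p \<and> x 1 = p)"
  unfolding periodic_values_def return_dom_def using return_map_eq by fastforce

text \<open>A line on which the field has constant weak sign is crossed in one direction only.\<close>

lemma line_dichotomy:
  assumes x: "solves S x" and t: "t \<in> {0..1}" "x t = l"
    and sgn: "(\<forall>s\<in>{0..1}. 0 \<le> S l s) \<or> (\<forall>s\<in>{0..1}. S l s \<le> 0)"
    and closed: "x 0 = x 1 \<or> (\<forall>s\<in>{0..1}. S l s = 0)"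
  shows "\<forall>s\<in>{0..1}. x s = l \<and> S l s = 0"
proof -
  define q where "q s = Q (x s) l s" for s
  have q: "continuous_on {0..1} q" unfolding q_def
    by (intro continuous_on_diff_quot continuous_on_const solves_continuous[OF x] continuous_on_id) auto
  define E where "E s = exp (- integral {0..s} q)" for s
  have E: "E s > 0" for s by (simp add: E_def)
  \<comment> \<open>\<open>f\<close> is the signed distance to the line with the linear term
    removed. Its derivative has the sign of the field on the line, so \<open>f\<close> is
    monotone.\<close>
  define f where "f s = (x s - l) * E s" for s
  have f': "(f has_real_derivative S l s * E s) (at s within {0..1})" if s: "s \<in> {0..1}" for s
  proof -
    have "((\<lambda>s. x s - l) has_real_derivative q s * (x s - l) + S l s) (at s within {0..1})"
      using x s poly_field_diff[of m a "x s" s l] unfolding solves_def q_def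
      by (auto intro!: derivative_eq_intros simp: mult.commute algebra_simps)
    from integrating_factor[OF q s this] show ?thesis unfolding f_def E_def .
  qed
  have ft: "f t = 0" using t by (simp add: f_def)
  \<comment> \<open>By monotonicity and \<open>f t = 0\<close>, the values \<open>x 0\<close> and
    \<open>x 1\<close> lie on opposite weak sides of \<open>l\<close>. If they coincide, both equal
    \<open>l\<close> and \<open>f\<close> is squeezed to 0; if the field vanishes on the line,
    \<open>f\<close> is constant.\<close>
  have f0: "f s = 0" if s: "s \<in> {0..1}" for s
  proof (cases "\<forall>s\<in>{0..1}. 0 \<le> S l s")
    case True
    have mono: "f u \<le> f v" if "0 \<le> u" "u \<le> v" "v \<le> 1" for u v
      using nonneg_deriv_imp_mono[OF f' _ that] True E by (simp add: less_imp_le)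
    consider "x 0 = x 1" | "\<forall>s\<in>{0..1}. S l s = 0" using closed by blast
    then show ?thesis
    proof cases
      case 1
      have "f 0 \<le> 0" "0 \<le> f 1" using mono[of 0 t] mono[of t 1] t ft by auto
      then have "x 0 - l \<le> 0" "0 \<le> x 1 - l" unfolding f_def using E
        by (simp_all add: mult_le_0_iff zero_le_mult_iff not_le[symmetric])
      then have "f 0 = 0" "f 1 = 0" using 1 by (auto simp: f_def)
      then show ?thesis using mono[of 0 s] mono[of s 1] s by auto
    next
      case 2
      then obtain c where "\<forall>s\<in>{0..1}. f s = c"
        using has_field_derivative_zero_constant[of "{0..1}" f] f' by fastforce
      then show ?thesis using ft t s by auto
    qed
  next
    case False
    then have neg: "\<forall>s\<in>{0..1}. S l s \<le> 0" using sgn by blast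
    have mono: "- f u \<le> - f v" if "0 \<le> u" "u \<le> v" "v \<le> 1" for u v
      using nonneg_deriv_imp_mono[of "\<lambda>s. - f s" "\<lambda>s. - (S l s * E s)" u v] DERIV_minus[OF f']
        that neg E by (simp add: mult_le_0_iff less_imp_le)
    from False closed have 1: "x 0 = x 1" by force
    have "0 \<le> f 0" "f 1 \<le> 0" using mono[of 0 t] mono[of t 1] t ft by auto
    then have "0 \<le> x 0 - l" "x 1 - l \<le> 0" unfolding f_def using E
      by (simp_all add: mult_le_0_iff zero_le_mult_iff not_le[symmetric])
    then have "f 0 = 0" "f 1 = 0" using 1 by (auto simp: f_def)
    then show ?thesis using mono[of 0 s] mono[of s 1] s by auto
  qed
  then have xl: "x s = l" if "s \<in> {0..1}" for s using that E[of s] by (force simp: f_def)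
  have "S l s = 0" if s: "s \<in> {0..1}" for s
  proof -
    have "(x has_real_derivative 0) (at s within {0..1})"
      by (rule has_field_derivative_transform_within[of "\<lambda>_. l" _ _ _ 1])
        (use xl s in auto)
    moreover have "(x has_real_derivative S l s) (at s within {0..1})"
      using x s xl[OF s] by (auto simp: solves_def)
    ultimately show ?thesis
      using s vector_derivative_unique_within[of s "{0..1}" x 0 "S l s"]
      by (simp add: has_real_derivative_iff_has_vector_derivative trivial_limit_within)
  qed
  with xl show ?thesis by blast
qed

end

section \<open>Existence of neighbouring solutions\<close>

text \<open>The weight \<open>exp (- K t)\<close> with \<open>K > L\<close> makes the Picard operator a contraction on the whole
  interval at once.\<close>

lemma global_solution_lipschitz:
  fixes T :: "real \<Rightarrow> real \<Rightarrow> real"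
  assumes cont: "continuous_on (UNIV \<times> {0..1}) (\<lambda>(x, t). T x t)"
    and lip: "\<And>x y t. t \<in> {0..1} \<Longrightarrow> \<bar>T x t - T y t\<bar> \<le> L * \<bar>x - y\<bar>" and "L \<ge> 0"
  obtains z where "z 0 = z0" "solves T z"
proof -
  define K where "K = L + 1"
  have K: "K > 0" "L < K" using \<open>L \<ge> 0\<close> by (auto simp: K_def)
  \<comment> \<open>Bounded continuous functions live on the whole real line, so time is clamped to
    the unit interval.\<close>
  define c where "c t = max 0 (min 1 t)" for t :: real
  have c01: "c t \<in> {0..1}" for t by (auto simp: c_def)
  have c_cont: "continuous_on A c" for A unfolding c_def by (intro continuous_intros)
  \<comment> \<open>The unknown \<open>u\<close> is the solution divided by
    \<open>exp (K s)\<close>; this puts the weight into the unknown and keeps the ordinary sup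
    norm.\<close>
  define g where "g u s = T (exp (K * s) * apply_bcontfun u s) s" for u :: "real \<Rightarrow>\<^sub>C real" and s
  have g_cont: "continuous_on {0..1} (g u)" for u
    unfolding g_def
    by (rule continuous_on_compose2[OF cont, where f="\<lambda>s. (exp (K * s) * apply_bcontfun u s, s)", simplified])
      (auto intro!: continuous_intros continuous_on_apply_bcontfun)
  define F where "F u t = exp (- K * c t) * (z0 + integral {0..c t} (g u))" for u t
  have F_bcont: "F u \<in> bcontfun" for u
  proof -
    let ?G = "\<lambda>t. exp (- K * t) * (z0 + integral {0..t} (g u))"
    have G: "continuous_on {0..1} ?G"
      by (intro continuous_intros indefinite_integral_continuous_1 integrable_continuous_real g_cont)
    have Fc: "F u = ?G \<circ> c" by (auto simp: F_def fun_eq_iff)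
    have "continuous_on UNIV (F u)" unfolding Fc
      by (rule continuous_on_compose[OF c_cont], rule continuous_on_subset[OF G]) (use c01 in auto)
    moreover have "bounded (?G ` {0..1})"
      by (intro compact_imp_bounded compact_continuous_image G) simp
    then have "bounded (range (F u))"
      by (rule bounded_subset) (use c01 in \<open>auto simp: Fc\<close>)
    ultimately show ?thesis by (simp add: bcontfun_def)
  qed
  define \<Phi> where "\<Phi> u = Bcontfun (F u)" for u
  have \<Phi>: "apply_bcontfun (\<Phi> u) = F u" for u
    using F_bcont by (simp add: \<Phi>_def Bcontfun_inverse)
  have contr: "dist (\<Phi> u) (\<Phi> v) \<le> L / K * dist u v" for u v
  proof (rule dist_bound)
    fix t
    define r where "r = c t"
    have r: "r \<in> {0..1}" using c01 by (simp add: r_def)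
    have sub: "{0..r} \<subseteq> {0..1}" using r by auto
    let ?d = "dist u v"
    have gi: "(g w) integrable_on {0..r}" for w
      by (intro integrable_continuous_real continuous_on_subset[OF g_cont sub])
    \<comment> \<open>Integrating \<open>exp (K s)\<close> gains a factor \<open>1 / K\<close>, and
      the weight in \<open>F\<close> cancels \<open>exp (K r)\<close>; what remains is the
      contraction constant \<open>L / K\<close>.\<close>
    have e: "((\<lambda>s. L * (exp (K * s) * ?d)) has_integral
        L * exp (K * r) / K * ?d - L * exp (K * 0) / K * ?d) {0..r}"
      using r K(1) by (intro fundamental_theorem_of_calculus)
        (auto simp flip: has_real_derivative_iff_has_vector_derivative intro!: derivative_eq_intros)
    have le: "norm (g u s - g v s) \<le> L * (exp (K * s) * ?d)" if "s \<in> {0..r}" for s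
    proof -
      have "norm (g u s - g v s) \<le> L * \<bar>exp (K * s) * apply_bcontfun u s - exp (K * s) * apply_bcontfun v s\<bar>"
        unfolding g_def real_norm_def using that sub by (intro lip) auto
      also have "\<dots> = L * (exp (K * s) * dist (apply_bcontfun u s) (apply_bcontfun v s))"
        by (simp add: dist_real_def abs_mult flip: right_diff_distrib)
      also have "\<dots> \<le> L * (exp (K * s) * ?d)"
        using \<open>L \<ge> 0\<close> by (intro mult_left_mono dist_bounded) auto
      finally show ?thesis .
    qed
    have "norm (integral {0..r} (\<lambda>s. g u s - g v s)) \<le> integral {0..r} (\<lambda>s. L * (exp (K * s) * ?d))"
      using le e by (intro integral_norm_bound_integral integrable_diff gi) (auto simp: has_integral_integrable)
    also have "\<dots> = L * exp (K * r) / K * ?d - L * exp (K * 0) / K * ?d"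
      using e by (rule integral_unique)
    also have "\<dots> \<le> L * exp (K * r) / K * ?d"
      using \<open>L \<ge> 0\<close> K(1) by simp
    finally have i: "\<bar>integral {0..r} (g u) - integral {0..r} (g v)\<bar> \<le> L * exp (K * r) / K * ?d"
      using gi by (simp add: integral_diff)
    have "dist (F u t) (F v t) = exp (- K * r) * \<bar>integral {0..r} (g u) - integral {0..r} (g v)\<bar>"
      by (simp add: F_def dist_real_def r_def abs_mult flip: right_diff_distrib)
    also have "\<dots> \<le> exp (- K * r) * (L * exp (K * r) / K * ?d)"
      using i by (intro mult_left_mono) auto
    also have "\<dots> = L / K * ?d"
      by (simp add: exp_minus field_simps)
    finally show "dist (apply_bcontfun (\<Phi> u) t) (apply_bcontfun (\<Phi> v) t) \<le> L / K * ?d"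
      by (simp add: \<Phi>)
  qed
  obtain u where u: "\<Phi> u = u"
    using banach_fix_type[of "L / K" \<Phi>] contr K \<open>L \<ge> 0\<close> by (auto simp: divide_simps)
  define z where "z t = z0 + integral {0..t} (g u)" for t
  have uz: "exp (K * t) * apply_bcontfun u t = z t" if "t \<in> {0..1}" for t
  proof -
    have "c t = t" using that by (auto simp: c_def)
    then have "apply_bcontfun u t = exp (- K * t) * z t"
      using \<Phi>[of u] u by (simp add: F_def z_def)
    then show ?thesis by (simp add: exp_minus)
  qed
  show ?thesis
  proof
    show "z 0 = z0" by (simp add: z_def)
    show "solves T z" unfolding solves_def
    proof
      fix t :: real assume t: "t \<in> {0..1}"
      have "(z has_real_derivative g u t) (at t within {0..1})"
        unfolding z_def using integral_has_real_derivative[OF g_cont t]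
        by (auto intro!: derivative_eq_intros)
      then show "(z has_real_derivative T (z t) t) (at t within {0..1})"
        using uz[OF t] by (simp add: g_def)
    qed
  qed
qed

text \<open>Gronwall's inequality for the squared distance, which is differentiable where the
  absolute value is not: multiplied by \<open>exp (- 2 * L * s)\<close> it does not
  increase.\<close>

lemma lipschitz_gronwall:
  assumes lip: "\<And>x y t. t \<in> {0..1} \<Longrightarrow> \<bar>T x t - T y t\<bar> \<le> L * \<bar>x - y\<bar>"
    and x: "solves T x" and y: "solves T y" and t: "t \<in> {0..1}" and "L \<ge> 0"
  shows "\<bar>y t - x t\<bar> \<le> \<bar>y 0 - x 0\<bar> * exp L"
proof -
  define f where "f s = - ((y s - x s)\<^sup>2 * exp (- 2 * L * s))" for s
  define f' where "f' s = 2 * exp (- 2 * L * s) *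
    (L * (y s - x s)\<^sup>2 - (y s - x s) * (T (y s) s - T (x s) s))" for s
  have "f 0 \<le> f t"
  proof (rule nonneg_deriv_imp_mono[of f f'])
    fix s :: real assume s: "s \<in> {0..1}"
    show "(f has_real_derivative f' s) (at s within {0..1})"
      using x y s unfolding solves_def f_def f'_def
      by (auto intro!: derivative_eq_intros simp: algebra_simps power2_eq_square)
    have "(y s - x s) * (T (y s) s - T (x s) s) \<le> \<bar>y s - x s\<bar> * \<bar>T (y s) s - T (x s) s\<bar>"
      by (simp flip: abs_mult)
    also have "\<dots> \<le> \<bar>y s - x s\<bar> * (L * \<bar>y s - x s\<bar>)"
      by (intro mult_left_mono lip s) auto
    also have "\<dots> = L * (y s - x s)\<^sup>2" by (simp add: power2_eq_square)
    finally show "0 \<le> f' s" by (simp add: f'_def)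
  qed (use t in auto)
  then have "(y t - x t)\<^sup>2 * exp (- 2 * L * t) \<le> (y 0 - x 0)\<^sup>2" by (simp add: f_def)
  then have "(y t - x t)\<^sup>2 \<le> (y 0 - x 0)\<^sup>2 * exp (2 * L * t)"
    by (simp add: exp_minus field_simps)
  also have "\<dots> \<le> (y 0 - x 0)\<^sup>2 * exp (2 * L)"
    using t \<open>L \<ge> 0\<close> by (intro mult_left_mono) (auto simp: mult_left_le)
  also have "\<dots> = (\<bar>y 0 - x 0\<bar> * exp L)\<^sup>2"
    by (simp add: power_mult_distrib exp_double)
  finally show ?thesis
    by (metis abs_ge_zero exp_ge_zero mult_nonneg_nonneg power2_abs power2_le_imp_le)
qed

context poly_ode
begin

text \<open>Clamping the state to \<open>[-M, M]\<close> makes the field globally Lipschitz, so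
  solutions of the clamped equation exist. With \<open>M\<close> one more than a bound for
  \<open>x\<close>, Gronwall keeps those starting within \<open>exp (- L)\<close> of
  \<open>x 0\<close> at distance at most 1 from \<open>x\<close>; there the clamp is inactive and
  they solve the original equation.\<close>

lemma nearby_solutions:
  assumes x: "solves S x"
  obtains e M where "e > 0" "M \<ge> 0"
    "\<And>z0. \<bar>z0 - x 0\<bar> < e \<Longrightarrow> \<exists>z. solves S z \<and> z 0 = z0 \<and> (\<forall>t\<in>{0..1}. \<bar>z t\<bar> \<le> M)"
proof -
  have "bounded (x ` {0..1})"
    by (intro compact_imp_bounded compact_continuous_image solves_continuous[OF x]) simp
  then obtain M0 where "M0 > 0" and M0': "\<forall>y\<in>x ` {0..1}. \<bar>y\<bar> \<le> M0"
    unfolding bounded_pos real_norm_def by blast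
  then have M0: "\<bar>x t\<bar> \<le> M0" if "t \<in> {0..1}" for t using that by blast
  define M where "M = M0 + 1"
  define c where "c y = max (- M) (min M y)" for y :: real
  have "M > 0" using \<open>M0 > 0\<close> by (simp add: M_def)
  have cM: "\<bar>c y\<bar> \<le> M" for y using \<open>M > 0\<close> by (auto simp: c_def)
  have c_id: "c y = y" if "\<bar>y\<bar> \<le> M" for y using that by (auto simp: c_def)
  have c_lip: "\<bar>c y - c z\<bar> \<le> \<bar>y - z\<bar>" for y z using \<open>M > 0\<close> by (auto simp: c_def)
  obtain L where "L \<ge> 0"
    and L: "\<And>x y t. t \<in> {0..1} \<Longrightarrow> \<bar>x\<bar> \<le> M \<Longrightarrow> \<bar>y\<bar> \<le> M \<Longrightarrow> \<bar>Q y x t\<bar> \<le> L"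
    using diff_quot_bounded[of M] by blast
  define T where "T y t = S (c y) t" for y t
  have T_cont: "continuous_on (UNIV \<times> {0..1}) (\<lambda>(y, t). T y t)"
    unfolding T_def c_def case_prod_beta
    by (intro continuous_on_field continuous_intros) auto
  have T_lip: "\<bar>T y t - T z t\<bar> \<le> L * \<bar>y - z\<bar>" if "t \<in> {0..1}" for y z t
  proof -
    have "\<bar>T y t - T z t\<bar> = \<bar>Q (c y) (c z) t\<bar> * \<bar>c y - c z\<bar>"
      by (simp add: T_def poly_field_diff abs_mult)
    also have "\<dots> \<le> L * \<bar>y - z\<bar>"
      using L[OF that cM cM] c_lip \<open>L \<ge> 0\<close> by (intro mult_mono) auto
    finally show ?thesis .
  qed
  have xT: "solves T x"
    using x M0 unfolding solves_def T_def M_def by (force simp: c_id M_def)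
  show ?thesis
  proof (rule that[of "exp (- L)" M])
    fix z0 assume z0: "\<bar>z0 - x 0\<bar> < exp (- L)"
    obtain z where z: "z 0 = z0" "solves T z"
      using global_solution_lipschitz[OF T_cont T_lip \<open>L \<ge> 0\<close>] by blast
    have zM: "\<bar>z t\<bar> \<le> M" if "t \<in> {0..1}" for t
    proof -
      have "\<bar>z t - x t\<bar> \<le> \<bar>z 0 - x 0\<bar> * exp L"
        by (rule lipschitz_gronwall[OF T_lip xT z(2) that \<open>L \<ge> 0\<close>])
      also have "\<dots> \<le> exp (- L) * exp L"
        using z0 z(1) by (intro mult_right_mono) auto
      also have "\<dots> = 1" by (simp add: exp_minus)
      finally show ?thesis using M0[OF that] by (simp add: M_def)
    qed
    then have "solves S z"
      using z(2) unfolding solves_def T_def by (simp add: c_id)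
    then show "\<exists>z. solves S z \<and> z 0 = z0 \<and> (\<forall>t\<in>{0..1}. \<bar>z t\<bar> \<le> M)"
      using z zM by blast
  qed (use \<open>M > 0\<close> in auto)
qed

end

section \<open>Derivatives of the return map\<close>

text \<open>An increment of \<open>f\<close> is split through \<open>f y (snd v)\<close>: the change
  of parameter is controlled uniformly in time by \<open>B\<close>, the change of time by continuity
  of \<open>f y\<close>.\<close>

lemma continuous_on_Times_uniform:
  fixes f :: "'a::topological_space \<Rightarrow> 'b::topological_space \<Rightarrow> real"
  assumes cont: "\<And>y. y \<in> U \<Longrightarrow> continuous_on T (f y)"
    and unif: "\<And>y. y \<in> U \<Longrightarrow> \<exists>B. continuous_on U B \<and> B y = 0 \<and>
      (\<forall>z\<in>U. \<forall>t\<in>T. \<bar>f z t - f y t\<bar> \<le> B z)"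
  shows "continuous_on (U \<times> T) (\<lambda>(z, t). f z t)"
  unfolding continuous_on_def
proof
  fix w assume "w \<in> U \<times> T"
  then obtain y s where w: "w = (y, s)" "y \<in> U" "s \<in> T" by auto
  obtain B where B: "continuous_on U B" "B y = 0" "\<And>z t. z \<in> U \<Longrightarrow> t \<in> T \<Longrightarrow> \<bar>f z t - f y t\<bar> \<le> B z"
    using unif[OF w(2)] by blast
  let ?F = "at w within U \<times> T"
  let ?G = "\<lambda>v. B (fst v) + \<bar>f y (snd v) - f y s\<bar>"
  have "continuous_on (U \<times> T) ?G"
    by (intro continuous_intros continuous_on_compose2[OF B(1)] continuous_on_compose2[OF cont[OF w(2)]])
      auto
  then have "(?G \<longlongrightarrow> ?G w) ?F"
    using \<open>w \<in> U \<times> T\<close> by (simp only: continuous_on_def)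
  then have lim: "(?G \<longlongrightarrow> 0) ?F" using B(2) w(1) by simp
  have "\<forall>\<^sub>F v in ?F. norm (f (fst v) (snd v) - f y s) \<le> ?G v"
    unfolding eventually_at_filter
  proof (intro always_eventually allI impI)
    fix v assume "v \<in> U \<times> T"
    then have "\<bar>f (fst v) (snd v) - f y (snd v)\<bar> \<le> B (fst v)" by (intro B(3)) auto
    then show "norm (f (fst v) (snd v) - f y s) \<le> ?G v" by simp
  qed
  from Lim_null_comparison[OF this lim] have "((\<lambda>v. f (fst v) (snd v) - f y s) \<longlongrightarrow> 0) ?F" .
  then have "((\<lambda>v. f (fst v) (snd v)) \<longlongrightarrow> f y s) ?F" by (rule LIM_zero_cancel)
  then show "((\<lambda>(z, t). f z t) \<longlongrightarrow> (case w of (z, t) \<Rightarrow> f z t)) ?F"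
    unfolding w(1) case_prod_beta by simp
qed

lemma continuous_on_integral_unit:
  fixes f :: "real \<Rightarrow> real \<Rightarrow> real"
  assumes "continuous_on (U \<times> {0..1}) (\<lambda>(z, t). f z t)"
  shows "continuous_on U (\<lambda>z. integral {0..1} (f z))"
  using integral_continuous_on_param[of U 0 1 f] assms by simp

text \<open>Caratheodory's form of the derivative. Since all difference quotients here are explicit,
  it replaces differentiation under the integral sign by continuity of parameter integrals.\<close>

lemma has_real_derivative_from_quotient:
  fixes f g :: "real \<Rightarrow> real"
  assumes U: "open U" "p \<in> U" and g: "continuous_on U g"
    and eq: "\<And>z. z \<in> U \<Longrightarrow> f z - f p = (z - p) * g z"
  shows "(f has_real_derivative g p) (at p)"
proof -
  have "(g \<longlongrightarrow> g p) (at p)"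
    using g U by (metis continuous_on_eq_continuous_at isCont_def)
  then have "((\<lambda>z. (f z - f p) / (z - p)) \<longlongrightarrow> g p) (at p)"
    by (rule Lim_transform_within_open[OF _ U]) (simp add: eq)
  then show ?thesis by (simp add: has_field_derivative_iff)
qed

text \<open>Padded by 0 at index \<open>m\<close>, so that the x-derivative is again a field with
  the same \<open>m\<close> and the locale applies to it.\<close>

definition deriv_coeff :: "nat \<Rightarrow> (nat \<Rightarrow> real \<Rightarrow> real) \<Rightarrow> nat \<Rightarrow> real \<Rightarrow> real" where
  "deriv_coeff m a i t = (if i < m then real (Suc i) * a (Suc i) t else 0)"

lemma diff_quot_diag: "diff_quot m a x x t = poly_field m (deriv_coeff m a) x t"
proof -
  have "diff_quot m a x x t = (\<Sum>i<Suc m. a i t * (real i * x ^ (i - 1)))"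
    unfolding diff_quot_def lessThan_Suc_atMost
    by (intro sum.cong) (auto simp flip: power_add)
  also have "\<dots> = (\<Sum>i<m. real (Suc i) * a (Suc i) t * x ^ i)"
    unfolding sum.lessThan_Suc_shift by (simp add: algebra_simps)
  also have "\<dots> = (\<Sum>i<Suc m. deriv_coeff m a i t * x ^ i)"
    unfolding sum.lessThan_Suc by (simp add: deriv_coeff_def)
  finally show ?thesis by (simp add: poly_field_def lessThan_Suc_atMost)
qed

lemma poly_field_has_derivative:
  "((\<lambda>x. poly_field m a x t) has_real_derivative diff_quot m a x x t) (at x)"
proof (rule has_real_derivative_from_quotient[of UNIV, where g = "\<lambda>y. diff_quot m a y x t"])
  show "continuous_on UNIV (\<lambda>y. diff_quot m a y x t)"
    unfolding diff_quot_def by (intro continuous_intros)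
qed (auto simp: poly_field_diff)

context poly_ode
begin

lemma poly_ode_deriv: "poly_ode m (deriv_coeff m a)"
proof
  show "continuous_on {0..1} (deriv_coeff m a i)" for i
    by (cases "i < m") (auto simp: deriv_coeff_def[abs_def] intro!: continuous_intros cont_coeff)
qed

abbreviation "Q2 \<equiv> diff_quot m (deriv_coeff m a)"

section \<open>Dependence of the flow on the initial value\<close>

definition flow :: "real \<Rightarrow> real \<Rightarrow> real" where
  "flow p = (SOME x. solves S x \<and> x 0 = p)"

lemma flow: "p \<in> return_dom S \<Longrightarrow> solves S (flow p)" "p \<in> return_dom S \<Longrightarrow> flow p 0 = p"
  unfolding flow_def return_dom_def by (metis (mono_tags, lifting) mem_Collect_eq someI_ex)+

lemma flow_eq:
  assumes "solves S x" "t \<in> {0..1}"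
  shows "flow (x 0) t = x t"
  using solution_unique[OF assms(1) _ _ assms(2)] flow solves_return_dom[OF assms(1)] by blast

lemma return_map_flow: "p \<in> return_dom S \<Longrightarrow> return_map S p = flow p 1"
  using return_map_eq flow by metis

text \<open>Nearby orbits share a bound \<open>M\<close>, hence \<open>Q\<close> along any two of
  them is at most a common \<open>L\<close>. The gap formula then makes the flow Lipschitz in the
  initial value, uniformly in time.\<close>

lemma flow_continuous_near:
  assumes "p \<in> return_dom S"
  obtains U where "open U" "p \<in> U" "U \<subseteq> return_dom S" "continuous_on (U \<times> {0..1}) (\<lambda>(z, t). flow z t)"
proof -
  obtain e M where "e > 0"
    and near: "\<And>z0. \<bar>z0 - p\<bar> < e \<Longrightarrow> \<exists>z. solves S z \<and> z 0 = z0 \<and> (\<forall>t\<in>{0..1}. \<bar>z t\<bar> \<le> M)"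
    using nearby_solutions[OF flow(1)[OF assms]] flow(2)[OF assms] by metis
  define U where "U = ball p e"
  have U: "z \<in> return_dom S" "t \<in> {0..1} \<Longrightarrow> \<bar>flow z t\<bar> \<le> M" if "z \<in> U" for z t
    using near[of z] that flow_eq solves_return_dom unfolding U_def
    by (fastforce simp: dist_real_def abs_minus_commute)+
  obtain L where L: "\<And>x y t. t \<in> {0..1} \<Longrightarrow> \<bar>x\<bar> \<le> M \<Longrightarrow> \<bar>y\<bar> \<le> M \<Longrightarrow> \<bar>Q y x t\<bar> \<le> L" "L \<ge> 0"
    using diff_quot_bounded[of M] by blast
  have lip: "\<bar>flow z t - flow y t\<bar> \<le> \<bar>z - y\<bar> * exp L" if zy: "z \<in> U" "y \<in> U" and t: "t \<in> {0..1}" for z y t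
  proof -
    have sol: "solves S (flow y)" "solves S (flow z)" using U(1) zy flow by auto
    have sub: "{0..t} \<subseteq> {0..1}" using t by auto
    have "integral {0..t} (\<lambda>s. Q (flow z s) (flow y s) s) \<le> integral {0..t} (\<lambda>s. L)"
    proof (rule integral_le)
      show "(\<lambda>s. Q (flow z s) (flow y s) s) integrable_on {0..t}"
        by (intro integrable_continuous_real
            continuous_on_subset[OF continuous_on_diff_quot_solutions[OF sol] sub])
      show "Q (flow z s) (flow y s) s \<le> L" if "s \<in> {0..t}" for s
        using L(1)[of s] U(2) zy that sub by (force simp: abs_le_iff)
    qed auto
    also have "\<dots> \<le> L" using t L(2) by (simp add: mult_left_le_one_le)
    finally show ?thesis
      using solution_diff[OF sol t] flow(2) U(1) zy by (simp add: abs_mult mult_left_mono)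
  qed
  have "continuous_on (U \<times> {0..1}) (\<lambda>(z, t). flow z t)"
  proof (rule continuous_on_Times_uniform)
    show "continuous_on {0..1} (flow y)" if "y \<in> U" for y
      using flow U(1) that solves_continuous by blast
    show "\<exists>B. continuous_on U B \<and> B y = 0 \<and> (\<forall>z\<in>U. \<forall>t\<in>{0..1}. \<bar>flow z t - flow y t\<bar> \<le> B z)"
      if "y \<in> U" for y
      by (rule exI[of _ "\<lambda>z. \<bar>z - y\<bar> * exp L"]) (use lip that in \<open>auto intro!: continuous_intros\<close>)
  qed
  moreover have "open U" "p \<in> U" "U \<subseteq> return_dom S" using U(1) \<open>e > 0\<close> by (auto simp: U_def)
  ultimately show ?thesis using that by blast
qed

lemma return_dom_open: "open (return_dom S)"
  unfolding open_subopen[of "return_dom S"]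
proof
  fix p assume "p \<in> return_dom S"
  then show "\<exists>U. open U \<and> p \<in> U \<and> U \<subseteq> return_dom S"
    by (rule flow_continuous_near) blast
qed

lemma continuous_on_flow_comp:
  assumes "continuous_on (U \<times> {0..1}) (\<lambda>(z, t). flow z t)"
    and "continuous_on D f" "continuous_on D h" "f ` D \<subseteq> U" "h ` D \<subseteq> {0..1}"
  shows "continuous_on D (\<lambda>v. flow (f v) (h v))"
proof -
  have "(\<lambda>v. (f v, h v)) ` D \<subseteq> U \<times> {0..1}" using assms(4,5) by auto
  from continuous_on_compose2[OF assms(1) continuous_on_Pair[OF assms(2,3)] this]
  show ?thesis by simp
qed

text \<open>By the gap formula the difference quotient of the return map is exactly the exponential
  of an integral of \<open>Q\<close> between two orbits, continuous in \<open>z\<close> up to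
  \<open>z = p\<close>.\<close>

lemma return_map_has_derivative:
  assumes "p \<in> return_dom S"
  shows "(return_map S has_real_derivative exp (integral {0..1} (\<lambda>s. Q (flow p s) (flow p s) s))) (at p)"
proof -
  obtain U where U: "open U" "p \<in> U" "U \<subseteq> return_dom S"
    and fc: "continuous_on (U \<times> {0..1}) (\<lambda>(z, t). flow z t)"
    using flow_continuous_near[OF assms] .
  have "continuous_on (U \<times> {0..1}) (\<lambda>(z, s). Q (flow z s) (flow p s) s)"
    unfolding case_prod_beta using U(2)
    by (intro continuous_on_diff_quot continuous_on_flow_comp[OF fc] continuous_intros) auto
  then have "continuous_on U (\<lambda>z. exp (integral {0..1} (\<lambda>s. Q (flow z s) (flow p s) s)))"
    by (intro continuous_on_exp continuous_on_integral_unit)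
  then show ?thesis
  proof (rule has_real_derivative_from_quotient[OF U(1,2)])
    fix z assume "z \<in> U"
    then have z: "z \<in> return_dom S" using U by auto
    show "return_map S z - return_map S p =
        (z - p) * exp (integral {0..1} (\<lambda>s. Q (flow z s) (flow p s) s))"
      using solution_diff[OF flow(1)[OF assms] flow(1)[OF z], of 1] flow(2) z assms
      by (simp add: return_map_flow)
  qed
qed

text \<open>The first derivative is \<open>exp (I z)\<close>, so only \<open>I\<close> has to be
  differentiated. Its integrand is itself a polynomial field along the orbit, so its increments
  factor through \<open>Q2\<close> and the gap between orbits. The function \<open>v\<close> is the
  derivative of the flow in the initial value.\<close>

lemma return_map_has_second_derivative:
  assumes p: "p \<in> return_dom S"
  defines "v \<equiv> \<lambda>t. exp (integral {0..t} (\<lambda>s. Q (flow p s) (flow p s) s))"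
  shows "(deriv (return_map S) has_real_derivative
    v 1 * integral {0..1} (\<lambda>t. Q2 (flow p t) (flow p t) t * v t)) (at p)"
proof -
  interpret d: poly_ode m "deriv_coeff m a" by (rule poly_ode_deriv)
  obtain U where U: "open U" "p \<in> U" "U \<subseteq> return_dom S"
    and fc: "continuous_on (U \<times> {0..1}) (\<lambda>(z, t). flow z t)"
    using flow_continuous_near[OF p] .
  have Qc: "continuous_on (U \<times> {0..1}) (\<lambda>(z, s). Q (flow z s) (flow p s) s)"
    unfolding case_prod_beta using U(2)
    by (intro continuous_on_diff_quot continuous_on_flow_comp[OF fc] continuous_intros) auto
  have Qi: "continuous_on {0..1} (\<lambda>s. Q (flow z s) (flow p s) s)" if "z \<in> U" for z
    using continuous_on_diff_quot_solutions flow(1) p that U(3) by blast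
  \<comment> \<open>For \<open>z\<close> different from \<open>p\<close>, \<open>exp (J z t)\<close>
    is the gap between the two orbits at time \<open>t\<close> divided by
    \<open>z - p\<close>.\<close>
  define J where "J z t = integral {0..t} (\<lambda>s. Q (flow z s) (flow p s) s)" for z t
  have Jc: "continuous_on (U \<times> {0..1}) (\<lambda>(z, t). J z t)"
  proof (rule continuous_on_Times_uniform)
    show "continuous_on {0..1} (J y)" if "y \<in> U" for y
      unfolding J_def by (intro indefinite_integral_continuous_1 integrable_continuous_real Qi that)
    fix y assume y: "y \<in> U"
    \<comment> \<open>The integral of \<open>?D z\<close> over the whole interval bounds
      \<open>J z t - J y t\<close> for all \<open>t\<close> at once and vanishes at
      \<open>z = y\<close>.\<close>
    let ?D = "\<lambda>z s. \<bar>Q (flow z s) (flow p s) s - Q (flow y s) (flow p s) s\<bar>"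
    have "continuous_on (U \<times> {0..1}) (\<lambda>(z, s). ?D z s)"
      unfolding case_prod_beta using U(2) y
      by (intro continuous_on_diff_quot continuous_on_flow_comp[OF fc] continuous_intros) auto
    then have "continuous_on U (\<lambda>z. integral {0..1} (?D z))"
      by (rule continuous_on_integral_unit)
    moreover have "\<bar>J z t - J y t\<bar> \<le> integral {0..1} (?D z)" if z: "z \<in> U" and t: "t \<in> {0..1}" for z t
    proof -
      have sub: "{0..t} \<subseteq> {0..1}" using t by auto
      have i: "(\<lambda>s. Q (flow w s) (flow p s) s) integrable_on {0..t}" if "w \<in> U" for w
        by (intro integrable_continuous_real continuous_on_subset[OF Qi sub] that)
      have Dc: "continuous_on {0..1} (?D z)" by (intro continuous_intros Qi z y)
      have "\<bar>J z t - J y t\<bar> = norm (integral {0..t} (\<lambda>s. Q (flow z s) (flow p s) s - Q (flow y s) (flow p s) s))"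
        using i z y by (simp add: J_def integral_diff)
      also have "\<dots> \<le> integral {0..t} (?D z)"
        by (intro integral_norm_bound_integral integrable_diff i z y integrable_continuous_real
            continuous_on_subset[OF Dc sub]) auto
      also have "\<dots> \<le> integral {0..1} (?D z)"
        by (intro integral_subset_le sub integrable_continuous_real Dc continuous_on_subset[OF Dc sub]) auto
      finally show ?thesis .
    qed
    ultimately show "\<exists>B. continuous_on U B \<and> B y = 0 \<and> (\<forall>z\<in>U. \<forall>t\<in>{0..1}. \<bar>J z t - J y t\<bar> \<le> B z)"
      by (intro exI[of _ "\<lambda>z. integral {0..1} (?D z)"]) auto
  qed
  have Jc': "continuous_on (U \<times> {0..1}) (\<lambda>w. J (fst w) (snd w))"
    using Jc by (simp add: case_prod_beta)
  define I where "I z = integral {0..1} (\<lambda>s. Q (flow z s) (flow z s) s)" for z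
  have "(I has_real_derivative
      integral {0..1} (\<lambda>t. Q2 (flow p t) (flow p t) t * exp (J p t))) (at p)"
  proof (rule has_real_derivative_from_quotient[OF U(1,2),
        where g = "\<lambda>z. integral {0..1} (\<lambda>t. Q2 (flow z t) (flow p t) t * exp (J z t))"])
    show "continuous_on U (\<lambda>z. integral {0..1} (\<lambda>t. Q2 (flow z t) (flow p t) t * exp (J z t)))"
      using U(2) unfolding case_prod_beta
      by (intro continuous_on_integral_unit, unfold case_prod_beta)
        (intro continuous_on_mult continuous_on_exp Jc' d.continuous_on_diff_quot
          continuous_on_flow_comp[OF fc] continuous_intros; auto)
    fix z assume z: "z \<in> U"
    then have zd: "z \<in> return_dom S" using U by auto
    have i: "(\<lambda>s. Q (flow w s) (flow w s) s) integrable_on {0..1}" if "w \<in> return_dom S" for w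
      by (intro integrable_continuous_real continuous_on_diff_quot_solutions flow that)
    have "I z - I p = integral {0..1} (\<lambda>t. Q (flow z t) (flow z t) t - Q (flow p t) (flow p t) t)"
      using i zd p by (simp add: I_def integral_diff)
    also have "\<dots> = integral {0..1} (\<lambda>t. (z - p) * (Q2 (flow z t) (flow p t) t * exp (J z t)))"
    proof (rule integral_cong)
      fix t :: real assume t: "t \<in> {0..1}"
      have "flow z t - flow p t = (z - p) * exp (J z t)"
        using solution_diff[OF flow(1)[OF p] flow(1)[OF zd] t] flow(2) zd p by (simp add: J_def)
      then show "Q (flow z t) (flow z t) t - Q (flow p t) (flow p t) t =
          (z - p) * (Q2 (flow z t) (flow p t) t * exp (J z t))"
        by (simp add: diff_quot_diag poly_field_diff)
    qed
    finally show "I z - I p = (z - p) * integral {0..1} (\<lambda>t. Q2 (flow z t) (flow p t) t * exp (J z t))"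
      by simp
  qed
  then have "((\<lambda>z. exp (I z)) has_real_derivative
      exp (I p) * integral {0..1} (\<lambda>t. Q2 (flow p t) (flow p t) t * exp (J p t))) (at p)"
    by (auto intro!: derivative_eq_intros)
  moreover have "exp (I z) = deriv (return_map S) z" if "z \<in> U" for z
    using DERIV_imp_deriv[OF return_map_has_derivative] that U by (auto simp: I_def)
  ultimately have "(deriv (return_map S) has_real_derivative
      exp (I p) * integral {0..1} (\<lambda>t. Q2 (flow p t) (flow p t) t * exp (J p t))) (at p)"
    by (rule has_field_derivative_transform_within_open[OF _ U(1,2)])
  then show ?thesis by (simp add: I_def J_def v_def)
qed

section \<open>Multiplicity bounds from the first two derivatives of the displacement\<close>

lemma order_of_zero_le: "(deriv ^^ k) f p \<noteq> 0 \<Longrightarrow> order_of_zero f p \<le> enat k"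
  unfolding order_of_zero_def by (intro Inf_lower) auto

lemma deriv_displacement:
  assumes "p \<in> return_dom S"
  shows "deriv (\<lambda>y. return_map S y - y) p = exp (integral {0..1} (\<lambda>s. Q (flow p s) (flow p s) s)) - 1"
  by (rule DERIV_imp_deriv) (auto intro!: derivative_eq_intros return_map_has_derivative assms)

text \<open>The displacement has derivative \<open>exp\<close> of this integral minus 1.\<close>

lemma multiplicity_le_1:
  assumes "solves S x" "integral {0..1} (\<lambda>s. Q (x s) (x s) s) \<noteq> 0"
  shows "multiplicity_at S (x 0) \<le> 1"
proof -
  have "integral {0..1} (\<lambda>s. Q (flow (x 0) s) (flow (x 0) s) s) = integral {0..1} (\<lambda>s. Q (x s) (x s) s)"
    using flow_eq[OF assms(1)] by (intro integral_cong) auto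
  then have "(deriv ^^ 1) (\<lambda>y. return_map S y - y) (x 0) \<noteq> 0"
    using assms deriv_displacement[OF solves_return_dom[OF assms(1)]] by simp
  from order_of_zero_le[OF this] show ?thesis
    by (simp add: multiplicity_at_def one_enat_def)
qed

lemma multiplicity_le_2:
  assumes x: "solves S x"
    and nz: "integral {0..1} (\<lambda>t. Q2 (x t) (x t) t * exp (integral {0..t} (\<lambda>s. Q (x s) (x s) s))) \<noteq> 0"
  shows "multiplicity_at S (x 0) \<le> 2"
proof -
  let ?p = "x 0" and ?H = "return_map S"
  have p: "?p \<in> return_dom S" by (rule solves_return_dom[OF x])
  have in1: "integral {0..t} (\<lambda>s. Q (flow ?p s) (flow ?p s) s) = integral {0..t} (\<lambda>s. Q (x s) (x s) s)"
    if "t \<in> {0..1}" for t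
    using flow_eq[OF x] that by (intro integral_cong) auto
  have in2: "integral {0..1} (\<lambda>t. Q2 (flow ?p t) (flow ?p t) t * exp (integral {0..t} (\<lambda>s. Q (flow ?p s) (flow ?p s) s)))
    = integral {0..1} (\<lambda>t. Q2 (x t) (x t) t * exp (integral {0..t} (\<lambda>s. Q (x s) (x s) s)))"
    using flow_eq[OF x] in1 by (intro integral_cong) auto
  have "((\<lambda>z. deriv ?H z - 1) has_real_derivative
      exp (integral {0..1} (\<lambda>s. Q (flow ?p s) (flow ?p s) s)) *
      integral {0..1} (\<lambda>t. Q2 (flow ?p t) (flow ?p t) t * exp (integral {0..t} (\<lambda>s. Q (flow ?p s) (flow ?p s) s)))) (at ?p)"
    by (auto intro!: derivative_eq_intros return_map_has_second_derivative[OF p])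
  \<comment> \<open>The identity holds on the open set \<open>return_dom S\<close>, hence near
    \<open>?p\<close>, so it may be differentiated once more there.\<close>
  moreover have "deriv ?H z - 1 = deriv (\<lambda>y. ?H y - y) z" if "z \<in> return_dom S" for z
    using DERIV_imp_deriv[OF return_map_has_derivative[OF that]] deriv_displacement[OF that] by simp
  ultimately have "(deriv (\<lambda>y. ?H y - y) has_real_derivative
      exp (integral {0..1} (\<lambda>s. Q (flow ?p s) (flow ?p s) s)) *
      integral {0..1} (\<lambda>t. Q2 (flow ?p t) (flow ?p t) t * exp (integral {0..t} (\<lambda>s. Q (flow ?p s) (flow ?p s) s)))) (at ?p)"
    by (rule has_field_derivative_transform_within_open[OF _ return_dom_open p])
  then have "(deriv ^^ 2) (\<lambda>y. ?H y - y) ?p \<noteq> 0"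
    using nz in2 by (simp add: numeral_2_eq_2 DERIV_imp_deriv)
  from order_of_zero_le[OF this] show ?thesis
    by (simp add: multiplicity_at_def numeral_eq_enat)
qed

lemma multiplicity_ge_1:
  assumes "p \<in> periodic_values S"
  shows "multiplicity_at S p \<ge> 1"
proof -
  have "return_map S p - p = 0" using assms by (simp add: periodic_values_def)
  then have "enat 1 \<le> enat k" if "(deriv ^^ k) (\<lambda>y. return_map S y - y) p \<noteq> 0" for k
    using that by (cases k) auto
  then show ?thesis unfolding multiplicity_at_def order_of_zero_def one_enat_def
    by (intro Inf_greatest) auto
qed

end

section \<open>Lagrange expansion along the lines\<close>

lemma degree_prod_linear: "degree (\<Prod>\<mu>\<in>L. [:- \<mu>, 1:]) = card L" for L :: "real set"
  by (subst degree_prod_eq_sum_degree) auto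

text \<open>The degree may exceed that of ordinary interpolation by one; the first term absorbs the
  top coefficient. The difference of the two sides then has degree below \<open>card L\<close> and
  vanishes at all \<open>card L\<close> nodes.\<close>

lemma lagrange_expansion:
  fixes L :: "real set"
  assumes fin: "finite L" and deg: "degree p \<le> card L"
  shows "poly p x = coeff p (card L) * (\<Prod>\<mu>\<in>L. x - \<mu>) +
    (\<Sum>\<nu>\<in>L. poly p \<nu> / (\<Prod>\<mu>\<in>L-{\<nu>}. \<nu> - \<mu>) * (\<Prod>\<mu>\<in>L-{\<nu>}. x - \<mu>))"
proof -
  define n where "n = card L"
  define W where "W \<nu> = (\<Prod>\<mu>\<in>L-{\<nu>}. \<nu> - \<mu>)" for \<nu>
  define f where "f = (\<Prod>\<mu>\<in>L. [:- \<mu>, 1:])"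
  define g where "g \<nu> = (\<Prod>\<mu>\<in>L-{\<nu>}. [:- \<mu>, 1:])" for \<nu>
  have f: "poly f y = (\<Prod>\<mu>\<in>L. y - \<mu>)" and g: "poly (g \<nu>) y = (\<Prod>\<mu>\<in>L-{\<nu>}. y - \<mu>)" for y \<nu>
    by (simp_all add: f_def g_def poly_prod)
  have W0: "W \<nu> \<noteq> 0" for \<nu> using fin by (simp add: W_def)
  define q where "q = smult (coeff p n) f + (\<Sum>\<nu>\<in>L. smult (poly p \<nu> / W \<nu>) (g \<nu>))"
  have degf: "degree f = n" by (simp add: f_def n_def degree_prod_linear)
  have "lead_coeff f = 1" unfolding f_def lead_coeff_prod by simp
  then have cf: "coeff f n = 1" by (simp add: degf)
  have degg: "degree (g \<nu>) < n" if "\<nu> \<in> L" for \<nu>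
    using that fin unfolding g_def degree_prod_linear n_def by (rule card_Diff1_less[rotated])
  have cq: "coeff q n = coeff p n"
    using degg by (simp add: q_def cf coeff_sum coeff_eq_0)
  have degq: "degree q \<le> n"
    unfolding q_def
  proof (intro degree_add_le degree_sum_le fin)
    show "degree (smult (coeff p n) f) \<le> n"
      using degree_smult_le degf by metis
    show "degree (smult (poly p \<nu> / W \<nu>) (g \<nu>)) \<le> n" if "\<nu> \<in> L" for \<nu>
      using degg[OF that] degree_smult_le[of _ "g \<nu>"] by (meson le_trans less_imp_le)
  qed
  have pq: "poly p \<kappa> = poly q \<kappa>" if \<kappa>: "\<kappa> \<in> L" for \<kappa>
  proof -
    have "poly f \<kappa> = 0" unfolding f using fin \<kappa> by (simp add: prod_zero_iff)
    moreover have "poly (g \<nu>) \<kappa> = 0" if "\<nu> \<in> L - {\<kappa>}" for \<nu>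
      unfolding g using fin \<kappa> that by (simp add: prod_zero_iff)
    then have "(\<Sum>\<nu>\<in>L. poly p \<nu> / W \<nu> * poly (g \<nu>) \<kappa>) = poly p \<kappa> / W \<kappa> * poly (g \<kappa>) \<kappa>"
      using fin \<kappa> by (subst sum.remove[of _ \<kappa>]) (auto intro!: sum.neutral)
    then have "(\<Sum>\<nu>\<in>L. poly p \<nu> / W \<nu> * poly (g \<nu>) \<kappa>) = poly p \<kappa>"
      using W0[of \<kappa>] by (simp add: g W_def)
    ultimately show ?thesis by (simp add: q_def poly_sum)
  qed
  have "p - q = 0"
  proof (rule ccontr)
    assume nz: "p - q \<noteq> 0"
    have "degree (p - q) \<le> n" using deg degq by (simp add: degree_diff_le n_def)
    moreover have "coeff (p - q) n = 0" by (simp add: cq)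
    ultimately have "degree (p - q) < n" using nz by (metis le_neq_implies_less leading_coeff_0_iff)
    moreover have "card L \<le> card {y. poly (p - q) y = 0}"
      using pq by (intro card_mono poly_roots_finite[OF nz]) auto
    then have "n \<le> degree (p - q)"
      using card_poly_roots_bound[OF nz] by (simp add: n_def)
    ultimately show False by simp
  qed
  then have "poly p x = poly q x" by simp
  then show ?thesis by (simp add: q_def poly_sum f g n_def W_def)
qed

lemma const_sign:
  fixes g :: "real \<Rightarrow> real"
  assumes g: "continuous_on {0..1} g" and nz: "\<And>t. t \<in> {0..1} \<Longrightarrow> g t \<noteq> 0"
    and "s \<in> {0..1}" "t \<in> {0..1}"
  shows "0 < g s \<longleftrightarrow> 0 < g t"
proof (rule ccontr)
  assume neq: "(0 < g s) \<noteq> (0 < g t)"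
  have conn: "connected (g ` {0..1})" by (intro connected_continuous_image g) simp
  have "0 \<in> {min (g s) (g t)..max (g s) (g t)}" using neq by auto
  moreover have "min (g s) (g t) \<in> g ` {0..1}" "max (g s) (g t) \<in> g ` {0..1}"
    using assms(3,4) by (auto simp: min_def max_def)
  ultimately have "0 \<in> g ` {0..1}" using connected_contains_Icc[OF conn] by blast
  then show False using nz by auto
qed

text \<open>Here \<open>c \<nu> t\<close> is the value of the field on the line divided by the
  derivative at \<open>\<nu>\<close> of the product over all lines. These derivatives alternate in
  sign along \<open>L\<close>, which turns alternation of the field into the common sign
  \<open>\<sigma>\<close>.\<close>

locale alternating_ode = poly_ode +
  fixes L :: "real set" and c :: "real \<Rightarrow> real \<Rightarrow> real" and \<sigma> :: real
  assumes fin: "finite L" and L_ne: "L \<noteq> {}"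
    and \<sigma>: "\<sigma> \<noteq> 0"
    and cont_c: "\<And>\<nu>. \<nu> \<in> L \<Longrightarrow> continuous_on {0..1} (c \<nu>)"
    and sign_c: "\<And>\<nu> t. \<nu> \<in> L \<Longrightarrow> t \<in> {0..1} \<Longrightarrow> 0 \<le> \<sigma> * c \<nu> t"
    and expansion: "\<And>x t. t \<in> {0..1} \<Longrightarrow> S x t =
      a m t * (\<Prod>\<mu>\<in>L. x - \<mu>) + (\<Sum>\<nu>\<in>L. c \<nu> t * (\<Prod>\<mu>\<in>L-{\<nu>}. x - \<mu>))"
begin

text \<open>The lines \<open>x = \<nu>\<close> with \<open>\<nu> \<in> A\<close> are the ones that are not solutions.\<close>

definition "A = {\<nu> \<in> L. \<exists>t\<in>{0..1}. c \<nu> t \<noteq> 0}"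

definition P :: "real poly" where "P = (\<Prod>\<mu>\<in>L. [:- \<mu>, 1:])"

text \<open>Only the poles in \<open>A\<close> are summed, so that \<open>R\<close> is also regular
  on the lines that are solutions.\<close>

definition "R x t = a m t + (\<Sum>\<nu>\<in>A. c \<nu> t / (x - \<nu>))"

definition "R' x t = (\<Sum>\<nu>\<in>A. - c \<nu> t / (x - \<nu>)\<^sup>2)"

text \<open>An antiderivative of \<open>1 / P\<close> off the lines, from partial fractions; half
  the logarithm of a square stands for the logarithm of the absolute value.\<close>

definition "Y x = (\<Sum>\<nu>\<in>L. ln ((x - \<nu>)\<^sup>2) / (2 * (\<Prod>\<mu>\<in>L-{\<nu>}. \<nu> - \<mu>)))"

section \<open>Factorisation of the field and its x-derivatives\<close>

lemma A_sub: "A \<subseteq> L" and fin_A: "finite A"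
  using fin by (auto simp: A_def)

lemma poly_P: "poly P x = (\<Prod>\<mu>\<in>L. x - \<mu>)"
  by (simp add: P_def poly_prod)

lemma poly_P_eq_0: "poly P x = 0 \<longleftrightarrow> x \<in> L"
  using fin by (auto simp: poly_P)

lemma P_split: "\<nu> \<in> L \<Longrightarrow> poly P x = (x - \<nu>) * (\<Prod>\<mu>\<in>L-{\<nu>}. x - \<mu>)"
  using fin by (simp add: poly_P prod.remove)

lemma node_weight_nonzero: "(\<Prod>\<mu>\<in>L-{\<nu>}. \<nu> - \<mu>) \<noteq> 0"
  using fin by simp

lemma pderiv_P:
  assumes "\<nu> \<in> L" shows "poly (pderiv P) \<nu> \<noteq> 0"
proof -
  have "(poly P has_real_derivative (\<Prod>\<mu>\<in>L-{\<nu>}. \<nu> - \<mu>)) (at \<nu>)"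
  proof (rule has_real_derivative_from_quotient[of UNIV, where g = "\<lambda>x. \<Prod>\<mu>\<in>L-{\<nu>}. x - \<mu>"])
    show "continuous_on UNIV (\<lambda>x. \<Prod>\<mu>\<in>L-{\<nu>}. x - \<mu>)"
      by (intro continuous_intros)
  qed (use assms in \<open>auto simp: P_split\<close>)
  then have "poly (pderiv P) \<nu> = (\<Prod>\<mu>\<in>L-{\<nu>}. \<nu> - \<mu>)"
    using poly_DERIV DERIV_unique by blast
  then show ?thesis using node_weight_nonzero by simp
qed

lemma field_on_line:
  assumes "\<nu> \<in> L" "t \<in> {0..1}"
  shows "S \<nu> t = c \<nu> t * (\<Prod>\<mu>\<in>L-{\<nu>}. \<nu> - \<mu>)"
proof -
  have "(\<Prod>\<mu>\<in>L. \<nu> - \<mu>) = 0" using assms fin by auto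
  moreover have "(\<Sum>\<kappa>\<in>L-{\<nu>}. c \<kappa> t * (\<Prod>\<mu>\<in>L-{\<kappa>}. \<nu> - \<mu>)) = 0"
    using assms fin by (intro sum.neutral) (auto simp: prod_zero_iff)
  ultimately show ?thesis using assms fin by (simp add: expansion sum.remove)
qed

text \<open>Lines outside \<open>A\<close> have zero coefficient, so only the poles in
  \<open>A\<close> must be avoided and the factorisation persists on the other lines.\<close>

lemma field_factor:
  assumes "x \<notin> A" "t \<in> {0..1}"
  shows "S x t = poly P x * R x t"
proof -
  have "(\<Sum>\<nu>\<in>L. c \<nu> t * (\<Prod>\<mu>\<in>L-{\<nu>}. x - \<mu>)) = (\<Sum>\<nu>\<in>A. c \<nu> t * (\<Prod>\<mu>\<in>L-{\<nu>}. x - \<mu>))"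
    using assms(2) fin A_sub by (intro sum.mono_neutral_right) (auto simp: A_def)
  also have "\<dots> = (\<Sum>\<nu>\<in>A. poly P x * (c \<nu> t / (x - \<nu>)))"
    using assms(1) A_sub by (intro sum.cong) (auto simp: P_split)
  finally show ?thesis
    using assms(2) by (simp add: expansion R_def poly_P distrib_left sum_distrib_left)
qed

lemma R_has_derivative:
  assumes "x \<notin> A" shows "((\<lambda>x. R x t) has_real_derivative R' x t) (at x)"
proof -
  have "((\<lambda>x. c \<nu> t / (x - \<nu>)) has_real_derivative - c \<nu> t / (x - \<nu>)\<^sup>2) (at x)" if "\<nu> \<in> A" for \<nu>
    using that assms by (auto intro!: derivative_eq_intros simp: power2_eq_square)
  then have "((\<lambda>x. \<Sum>\<nu>\<in>A. c \<nu> t / (x - \<nu>)) has_real_derivative R' x t) (at x)"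
    unfolding R'_def by (rule DERIV_sum)
  from DERIV_add[OF DERIV_const this, of "a m t"] show ?thesis by (simp add: R_def)
qed

text \<open>Mere existence suffices: on a line this derivative enters with the factor
  \<open>poly P x = 0\<close>.\<close>

lemma R'_has_derivative:
  assumes "x \<notin> A" shows "\<exists>d. ((\<lambda>x. R' x t) has_real_derivative d) (at x)"
proof -
  have "((\<lambda>x. - c \<nu> t / (x - \<nu>)\<^sup>2) has_real_derivative
      - ((- c \<nu> t) * (2 * (x - \<nu>))) / ((x - \<nu>)\<^sup>2 * (x - \<nu>)\<^sup>2)) (at x)" if "\<nu> \<in> A" for \<nu>
    using that assms by (auto intro!: derivative_eq_intros)
  then show ?thesis unfolding R'_def
    by (intro exI) (rule DERIV_sum, assumption)
qed

text \<open>Both sides are the x-derivative of the field, since the factorisation holds on the open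
  complement of \<open>A\<close>.\<close>

lemma Q_diag:
  assumes x: "x \<notin> A" and t: "t \<in> {0..1}"
  shows "Q x x t = poly (pderiv P) x * R x t + poly P x * R' x t"
proof -
  have op: "open (- A)" using fin_A by (simp add: finite_imp_closed open_Compl)
  have "((\<lambda>x. poly P x * R x t) has_real_derivative
      poly (pderiv P) x * R x t + poly P x * R' x t) (at x)"
    using DERIV_mult[OF poly_DERIV R_has_derivative[OF x]] by (simp add: mult.commute add.commute)
  then have "((\<lambda>x. S x t) has_real_derivative
      poly (pderiv P) x * R x t + poly P x * R' x t) (at x)"
    by (rule has_field_derivative_transform_within_open[OF _ op]) (use x t in \<open>auto simp: field_factor\<close>)
  then show ?thesis using poly_field_has_derivative DERIV_unique by blast
qed

lemma Q2_diag_line: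
  assumes x: "x \<in> L - A" and t: "t \<in> {0..1}"
  shows "Q2 x x t = poly (pderiv (pderiv P)) x * R x t + 2 * poly (pderiv P) x * R' x t"
proof -
  have xA: "x \<notin> A" and P0: "poly P x = 0" using x by (auto simp: poly_P_eq_0)
  have op: "open (- A)" using fin_A by (simp add: finite_imp_closed open_Compl)
  obtain d where d: "((\<lambda>x. R' x t) has_real_derivative d) (at x)"
    using R'_has_derivative[OF xA] by blast
  have "((\<lambda>x. poly (pderiv P) x * R x t + poly P x * R' x t) has_real_derivative
      poly (pderiv (pderiv P)) x * R x t + 2 * poly (pderiv P) x * R' x t) (at x)"
    using DERIV_add[OF DERIV_mult[OF poly_DERIV R_has_derivative[OF xA]] DERIV_mult[OF poly_DERIV d]]
    by (rule DERIV_cong) (simp add: P0)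
  then have "((\<lambda>x. Q x x t) has_real_derivative
      poly (pderiv (pderiv P)) x * R x t + 2 * poly (pderiv P) x * R' x t) (at x)"
    by (rule has_field_derivative_transform_within_open[OF _ op]) (use xA t in \<open>auto simp: Q_diag\<close>)
  then have "((\<lambda>x. poly_field m (deriv_coeff m a) x t) has_real_derivative
      poly (pderiv (pderiv P)) x * R x t + 2 * poly (pderiv P) x * R' x t) (at x)"
    by (simp add: diff_quot_diag)
  then show ?thesis using poly_field_has_derivative DERIV_unique by blast
qed

lemma Y_has_derivative:
  assumes "x \<notin> L" shows "(Y has_real_derivative 1 / poly P x) (at x)"
proof -
  let ?w = "\<lambda>\<nu>. \<Prod>\<mu>\<in>L-{\<nu>}. \<nu> - \<mu>"
  have card: "card L \<noteq> 0" using fin L_ne by simp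
  \<comment> \<open>Interpolating the constant 1 gives the partial fractions of
    \<open>1 / P\<close>; its coefficient at \<open>card L\<close> is 0 because \<open>L\<close> is
    nonempty.\<close>
  have "1 = (\<Sum>\<nu>\<in>L. 1 / ?w \<nu> * (\<Prod>\<mu>\<in>L-{\<nu>}. x - \<mu>))"
    using lagrange_expansion[OF fin, of 1 x] card by simp
  also have "\<dots> = poly P x * (\<Sum>\<nu>\<in>L. 1 / ((x - \<nu>) * ?w \<nu>))"
    unfolding sum_distrib_left using assms by (intro sum.cong) (auto simp: P_split)
  finally have eq: "1 / poly P x = (\<Sum>\<nu>\<in>L. 1 / ((x - \<nu>) * ?w \<nu>))"
    using assms poly_P_eq_0[of x] by (simp add: field_simps)
  have "((\<lambda>x. ln ((x - \<nu>)\<^sup>2) / (2 * ?w \<nu>)) has_real_derivative 1 / ((x - \<nu>) * ?w \<nu>)) (at x)"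
    if "\<nu> \<in> L" for \<nu>
  proof -
    have "x \<noteq> \<nu>" using that assms by auto
    then have "((\<lambda>x. ln ((x - \<nu>)\<^sup>2)) has_real_derivative 1 / (x - \<nu>)\<^sup>2 * (2 * (x - \<nu>))) (at x)"
      by (intro DERIV_chain2[OF DERIV_ln_divide]) (auto intro!: derivative_eq_intros)
    then have "((\<lambda>x. ln ((x - \<nu>)\<^sup>2)) has_real_derivative 2 / (x - \<nu>)) (at x)"
      by (rule DERIV_cong) (use \<open>x \<noteq> \<nu>\<close> in \<open>simp add: power2_eq_square del: right_diff_distrib_numeral\<close>)
    from DERIV_cdivide[OF this, of "2 * ?w \<nu>"] show ?thesis by simp
  qed
  then show ?thesis unfolding Y_def eq by (rule DERIV_sum)
qed

end

section \<open>Periodic solutions and their multiplicities\<close>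

context alternating_ode
begin

lemma field_sign_on_line:
  assumes "\<nu> \<in> L"
  shows "(\<forall>t\<in>{0..1}. 0 \<le> S \<nu> t) \<or> (\<forall>t\<in>{0..1}. S \<nu> t \<le> 0)"
proof -
  let ?w = "\<Prod>\<mu>\<in>L-{\<nu>}. \<nu> - \<mu>"
  have "0 \<le> c \<nu> t \<or> \<sigma> < 0" "c \<nu> t \<le> 0 \<or> 0 < \<sigma>" if "t \<in> {0..1}" for t
    using sign_c[OF assms that] \<sigma> by (auto simp: zero_le_mult_iff)
  then have "(\<forall>t\<in>{0..1}. 0 \<le> c \<nu> t) \<or> (\<forall>t\<in>{0..1}. c \<nu> t \<le> 0)" by (meson less_asym)
  then show ?thesis using assms
    by (cases "0 \<le> ?w") (auto simp: field_on_line mult_le_0_iff zero_le_mult_iff)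
qed

lemma field_zero_on_line:
  "\<nu> \<in> L \<Longrightarrow> \<nu> \<notin> A \<Longrightarrow> t \<in> {0..1} \<Longrightarrow> S \<nu> t = 0"
  by (auto simp: field_on_line A_def)

text \<open>The final alternative covers two uses: periodic orbits against any line, and arbitrary
  solutions in the degenerate case \<open>A = {}\<close>.\<close>

lemma solution_meets_line:
  assumes "solves S x" "\<nu> \<in> L" "t \<in> {0..1}" "x t = \<nu>" and "x 0 = x 1 \<or> \<nu> \<notin> A"
  shows "\<nu> \<notin> A" "s \<in> {0..1} \<Longrightarrow> x s = \<nu>"
proof -
  have "x 0 = x 1 \<or> (\<forall>s\<in>{0..1}. S \<nu> s = 0)"
    using assms(2,5) field_zero_on_line by blast
  note * = line_dichotomy[OF assms(1,3,4) field_sign_on_line[OF assms(2)] this]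
  show "s \<in> {0..1} \<Longrightarrow> x s = \<nu>" using * by blast
  have "c \<nu> s = 0" if "s \<in> {0..1}" for s
    using * that assms(2) node_weight_nonzero field_on_line by (metis mult_eq_0_iff)
  then show "\<nu> \<notin> A" by (auto simp: A_def)
qed

lemma periodic_avoids_A:
  assumes "solves S x" "x 0 = x 1" "t \<in> {0..1}"
  shows "x t \<notin> A"
  using solution_meets_line(1)[OF assms(1) _ assms(3) refl] assms(2) A_sub by blast

lemma line_solution:
  assumes "\<nu> \<in> L - A" shows "solves S (\<lambda>_. \<nu>)"
  using assms field_zero_on_line unfolding solves_def by auto

lemma continuous_on_R:
  assumes "continuous_on {0..1} x" "\<And>t. t \<in> {0..1} \<Longrightarrow> x t \<notin> A"
  shows "continuous_on {0..1} (\<lambda>t. R (x t) t)" "continuous_on {0..1} (\<lambda>t. R' (x t) t)"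
  unfolding R_def R'_def using assms A_sub cont_coeff cont_c
  by (auto intro!: continuous_intros)

text \<open>Separation of variables: along the orbit \<open>Y\<close> has derivative
  \<open>S / P = R\<close>.\<close>

lemma integral_R_off_lines:
  assumes "solves S x" "\<And>t. t \<in> {0..1} \<Longrightarrow> x t \<notin> L"
  shows "integral {0..1} (\<lambda>t. R (x t) t) = Y (x 1) - Y (x 0)"
proof (rule ftc_unit)
  fix t :: real assume t: "t \<in> {0..1}"
  have x: "(x has_real_derivative S (x t) t) (at t within {0..1})"
    using assms(1) t by (auto simp: solves_def)
  have "S (x t) t = poly P (x t) * R (x t) t" "poly P (x t) \<noteq> 0"
    using assms(2)[OF t] A_sub t by (auto intro!: field_factor simp: poly_P_eq_0)
  then show "((\<lambda>t. Y (x t)) has_real_derivative R (x t) t) (at t within {0..1})"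
    using DERIV_chain2[OF Y_has_derivative[OF assms(2)[OF t]] x] by simp
qed

text \<open>\<open>R\<close> depends on the state only through \<open>1 / (x - \<nu>)\<close>, with
  weights of one sign, and some weight is nonzero at some time, which gives strictness. Comparing
  these reciprocals instead of \<open>x\<close> and \<open>y\<close> also covers orbits on opposite
  sides of all poles.\<close>

lemma R_strict_compare:
  assumes A: "A \<noteq> {}" and x: "continuous_on {0..1} x" "\<And>t. t \<in> {0..1} \<Longrightarrow> x t \<notin> A"
    and y: "continuous_on {0..1} y" "\<And>t. t \<in> {0..1} \<Longrightarrow> y t \<notin> A"
    and less: "\<And>\<nu> t. \<nu> \<in> A \<Longrightarrow> t \<in> {0..1} \<Longrightarrow> 1 / (y t - \<nu>) < 1 / (x t - \<nu>)"
  shows "integral {0..1} (\<lambda>t. R (x t) t) \<noteq> integral {0..1} (\<lambda>t. R (y t) t)"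
proof -
  obtain \<nu>0 t0 where \<nu>0: "\<nu>0 \<in> A" "t0 \<in> {0..1}" "c \<nu>0 t0 \<noteq> 0" using A unfolding A_def by blast
  let ?h = "\<lambda>\<nu> t. \<sigma> * c \<nu> t * (1 / (x t - \<nu>) - 1 / (y t - \<nu>))"
  have eq: "\<sigma> * (R (x t) t - R (y t) t) = (\<Sum>\<nu>\<in>A. ?h \<nu> t)" for t
    by (simp add: R_def sum_distrib_left right_diff_distrib flip: sum_subtractf)
  have h: "0 \<le> ?h \<nu> t" if "\<nu> \<in> A" "t \<in> {0..1}" for \<nu> t
  proof (rule mult_nonneg_nonneg)
    show "0 \<le> \<sigma> * c \<nu> t" using sign_c A_sub that by blast
  qed (use less[OF that] in simp)
  have "0 < integral {0..1} (\<lambda>t. \<sigma> * (R (x t) t - R (y t) t))"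
  proof (rule integral_unit_pos)
    show "continuous_on {0..1} (\<lambda>t. \<sigma> * (R (x t) t - R (y t) t))"
      by (intro continuous_intros continuous_on_R x y)
    show "0 \<le> \<sigma> * (R (x t) t - R (y t) t)" if "t \<in> {0..1}" for t
      unfolding eq using h that by (intro sum_nonneg) auto
    have "?h \<nu>0 t0 \<noteq> 0" using \<nu>0 \<sigma> less[of \<nu>0 t0] by auto
    then show "\<sigma> * (R (x t0) t0 - R (y t0) t0) \<noteq> 0"
      unfolding eq using h \<nu>0 fin_A by (subst sum_nonneg_eq_0_iff) auto
  qed fact
  moreover have "(\<lambda>t. R (x t) t) integrable_on {0..1}" "(\<lambda>t. R (y t) t) integrable_on {0..1}"
    using continuous_on_R(1)[OF x] continuous_on_R(1)[OF y] integrable_continuous_real by blast+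
  ultimately show ?thesis by (auto simp: integral_diff)
qed

text \<open>\<open>- \<sigma> * R'\<close> is a sum of nonnegative terms that is positive somewhere,
  and a continuous \<open>w\<close> without zeros keeps one sign, recorded in
  \<open>\<epsilon>\<close>.\<close>

lemma integral_R'_weighted:
  assumes A: "A \<noteq> {}" and x: "continuous_on {0..1} x" "\<And>t. t \<in> {0..1} \<Longrightarrow> x t \<notin> A"
    and w: "continuous_on {0..1} w" "\<And>t. t \<in> {0..1} \<Longrightarrow> w t \<noteq> 0"
  shows "integral {0..1} (\<lambda>t. w t * R' (x t) t) \<noteq> 0"
proof -
  obtain \<nu>0 t0 where \<nu>0: "\<nu>0 \<in> A" "t0 \<in> {0..1}" "c \<nu>0 t0 \<noteq> 0" using A unfolding A_def by blast
  define \<epsilon> :: real where "\<epsilon> = (if 0 < w 0 then 1 else - 1)"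
  have \<epsilon>w: "0 < \<epsilon> * w t" if "t \<in> {0..1}" for t
    using const_sign[OF w, of 0 t] w(2)[OF that] that by (auto simp: \<epsilon>_def split: if_splits)
  let ?h = "\<lambda>\<nu> t. \<sigma> * c \<nu> t / (x t - \<nu>)\<^sup>2"
  have eq: "- \<sigma> * R' (x t) t = (\<Sum>\<nu>\<in>A. ?h \<nu> t)" for t
    by (simp add: R'_def sum_distrib_left sum_negf)
  have h: "0 \<le> ?h \<nu> t" if "\<nu> \<in> A" "t \<in> {0..1}" for \<nu> t
    using sign_c A_sub that by (intro divide_nonneg_nonneg) auto
  have "0 < integral {0..1} (\<lambda>t. (\<epsilon> * w t) * (- \<sigma> * R' (x t) t))"
  proof (rule integral_unit_pos)
    show "continuous_on {0..1} (\<lambda>t. (\<epsilon> * w t) * (- \<sigma> * R' (x t) t))"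
      by (intro continuous_intros continuous_on_R x w)
    show "0 \<le> (\<epsilon> * w t) * (- \<sigma> * R' (x t) t)" if "t \<in> {0..1}" for t
      unfolding eq using h that \<epsilon>w[OF that]
      by (intro mult_nonneg_nonneg[of "\<epsilon> * w t"] sum_nonneg) auto
    have "?h \<nu>0 t0 \<noteq> 0" using \<nu>0 \<sigma> x(2)[of t0] by auto
    then have "- \<sigma> * R' (x t0) t0 \<noteq> 0"
      unfolding eq using h \<nu>0 fin_A by (subst sum_nonneg_eq_0_iff) auto
    then show "(\<epsilon> * w t0) * (- \<sigma> * R' (x t0) t0) \<noteq> 0" using \<epsilon>w[OF \<nu>0(2)] by auto
  qed fact
  also have "(\<lambda>t. (\<epsilon> * w t) * (- \<sigma> * R' (x t) t)) = (\<lambda>t. (- \<epsilon> * \<sigma>) * (w t * R' (x t) t))"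
    by (simp add: mult_ac fun_eq_iff)
  finally show ?thesis by (auto simp: integral_mult_right)
qed

text \<open>Along a periodic orbit off the lines, \<open>S\<^sub>x = P'(x) R + P(x) R\<^sub>x\<close> and
  \<open>P'(x) R = d/dt ln \<bar>P(x)\<bar>\<close> integrates to zero, so the sign of \<open>R\<^sub>x\<close> decides.\<close>

lemma hyperbolic_off_lines:
  assumes A: "A \<noteq> {}" and x: "solves S x" "x 0 = x 1" "\<And>t. t \<in> {0..1} \<Longrightarrow> x t \<notin> L"
  shows "integral {0..1} (\<lambda>t. Q (x t) (x t) t) \<noteq> 0"
proof -
  have xc: "continuous_on {0..1} x" and xA: "\<And>t. t \<in> {0..1} \<Longrightarrow> x t \<notin> A"
    using solves_continuous x A_sub by auto
  have P0: "poly P (x t) \<noteq> 0" if "t \<in> {0..1}" for t using x(3) that by (simp add: poly_P_eq_0)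
  have pc: "continuous_on {0..1} (\<lambda>t. poly p (x t))" for p
    by (intro continuous_on_poly xc)
  have "integral {0..1} (\<lambda>t. poly (pderiv P) (x t) * R (x t) t) =
      ln ((poly P (x 1))\<^sup>2) / 2 - ln ((poly P (x 0))\<^sup>2) / 2"
  proof (rule ftc_unit)
    fix t :: real assume t: "t \<in> {0..1}"
    have "(x has_real_derivative poly P (x t) * R (x t) t) (at t within {0..1})"
      unfolding field_factor[OF xA[OF t] t, symmetric] using x(1) t by (auto simp: solves_def)
    from DERIV_power[OF DERIV_chain2[OF poly_DERIV this], where n = 2]
    have "((\<lambda>t. (poly P (x t))\<^sup>2) has_real_derivative
        2 * (poly (pderiv P) (x t) * (poly P (x t) * R (x t) t) * poly P (x t))) (at t within {0..1})"
      by (rule DERIV_cong) simp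
    from DERIV_cdivide[OF DERIV_chain2[OF DERIV_ln_divide this], of 2] P0[OF t]
      zero_less_power2[of "poly P (x t)"]
    show "((\<lambda>t. ln ((poly P (x t))\<^sup>2) / 2) has_real_derivative poly (pderiv P) (x t) * R (x t) t)
        (at t within {0..1})"
      by (simp add: power2_eq_square)
  qed
  also have "\<dots> = 0" using x(2) by simp
  finally have "integral {0..1} (\<lambda>t. poly (pderiv P) (x t) * R (x t) t + poly P (x t) * R' (x t) t)
      = integral {0..1} (\<lambda>t. poly P (x t) * R' (x t) t)"
    by (subst integral_add)
      (auto intro!: integrable_continuous_real continuous_on_mult pc continuous_on_R xc xA)
  also have "\<dots> \<noteq> 0" by (rule integral_R'_weighted[OF A xc xA pc P0])
  finally show ?thesis
    by (subst integral_cong[of _ _ "\<lambda>t. poly (pderiv P) (x t) * R (x t) t + poly P (x t) * R' (x t) t"])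
      (auto intro!: Q_diag xA)
qed

lemma multiplicity_off_lines:
  assumes A: "A \<noteq> {}" and x: "solves S x" "x 0 = x 1" "\<And>t. t \<in> {0..1} \<Longrightarrow> x t \<notin> L"
  shows "multiplicity_at S (x 0) \<le> 1"
  by (rule multiplicity_le_1[OF x(1) hyperbolic_off_lines[OF A x]])

text \<open>On the line \<open>P\<close> vanishes, so \<open>Q\<close> reduces to \<open>R\<close>
  times the nonzero derivative of \<open>P\<close>.\<close>

lemma line_multiplicity_1:
  assumes \<nu>: "\<nu> \<in> L - A" and nz: "integral {0..1} (\<lambda>t. R \<nu> t) \<noteq> 0"
  shows "multiplicity_at S \<nu> \<le> 1"
proof -
  have "integral {0..1} (\<lambda>t. Q \<nu> \<nu> t) = integral {0..1} (\<lambda>t. poly (pderiv P) \<nu> * R \<nu> t)"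
    using \<nu> by (intro integral_cong) (auto simp: Q_diag poly_P_eq_0)
  then have "integral {0..1} (\<lambda>t. Q \<nu> \<nu> t) \<noteq> 0"
    using nz pderiv_P \<nu> by auto
  from multiplicity_le_1[OF line_solution[OF \<nu>] this] show ?thesis .
qed

text \<open>With \<open>v = \<partial>x/\<partial>x\<^sub>0\<close> one has \<open>v' = P'(\<nu>) R v\<close>, so in
  \<open>S\<^sub>x\<^sub>x v = P''(\<nu>) R v + 2 P'(\<nu>) R\<^sub>x v\<close> the first term integrates to a multiple of
  \<open>v 1 - v 0 = 0\<close>.\<close>

lemma line_multiplicity_2:
  assumes A: "A \<noteq> {}" and \<nu>: "\<nu> \<in> L - A" and z: "integral {0..1} (\<lambda>t. R \<nu> t) = 0"
  shows "multiplicity_at S \<nu> \<le> 2"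
proof -
  let ?d = "poly (pderiv P) \<nu>" and ?dd = "poly (pderiv (pderiv P)) \<nu>"
  have d: "?d \<noteq> 0" using pderiv_P \<nu> by simp
  have Rc: "continuous_on {0..1} (\<lambda>t. R \<nu> t)" and R'c: "continuous_on {0..1} (\<lambda>t. R' \<nu> t)"
    using continuous_on_R[of "\<lambda>_. \<nu>"] \<nu> by auto
  have qc: "continuous_on {0..1} (\<lambda>t. ?d * R \<nu> t)" by (intro continuous_intros Rc)
  define v where "v t = exp (integral {0..t} (\<lambda>s. ?d * R \<nu> s))" for t
  have v': "(v has_real_derivative ?d * R \<nu> t * v t) (at t within {0..1})" if "t \<in> {0..1}" for t
    unfolding v_def
    by (rule DERIV_cong[OF DERIV_chain2[OF DERIV_exp integral_has_real_derivative[OF qc that]]])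
      (rule mult.commute)
  have vc: "continuous_on {0..1} v"
    using v' DERIV_continuous by (force simp: continuous_on_eq_continuous_within)
  have "integral {0..1} (\<lambda>t. ?d * R \<nu> t * v t) = v 1 - v 0" by (rule ftc_unit[OF v'])
  also have "\<dots> = 0" using z by (simp add: v_def)
  finally have "?d * integral {0..1} (\<lambda>t. R \<nu> t * v t) = 0"
    by (simp add: mult.assoc)
  then have Rv: "integral {0..1} (\<lambda>t. R \<nu> t * v t) = 0" using d by simp
  have R'v: "integral {0..1} (\<lambda>t. v t * R' \<nu> t) \<noteq> 0"
    by (rule integral_R'_weighted[OF A]) (use \<nu> vc in \<open>auto simp: v_def\<close>)
  have "integral {0..1} (\<lambda>t. Q2 \<nu> \<nu> t * exp (integral {0..t} (\<lambda>s. Q \<nu> \<nu> s))) =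
      integral {0..1} (\<lambda>t. ?dd * (R \<nu> t * v t) + 2 * ?d * (v t * R' \<nu> t))"
  proof (rule integral_cong)
    fix t :: real assume t: "t \<in> {0..1}"
    have "integral {0..t} (\<lambda>s. Q \<nu> \<nu> s) = integral {0..t} (\<lambda>s. ?d * R \<nu> s)"
      using \<nu> t by (intro integral_cong) (auto simp: Q_diag poly_P_eq_0)
    then show "Q2 \<nu> \<nu> t * exp (integral {0..t} (\<lambda>s. Q \<nu> \<nu> s)) =
        ?dd * (R \<nu> t * v t) + 2 * ?d * (v t * R' \<nu> t)"
      using Q2_diag_line[OF \<nu> t] by (simp add: v_def algebra_simps)
  qed
  also have "\<dots> = 2 * ?d * integral {0..1} (\<lambda>t. v t * R' \<nu> t)"
    by (subst integral_add)
      (auto intro!: integrable_continuous_real continuous_intros Rc R'c vc simp: Rv)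
  also have "\<dots> \<noteq> 0" using d R'v by simp
  finally show ?thesis using multiplicity_le_2[OF line_solution[OF \<nu>]] by simp
qed

end

section \<open>Counting periodic solutions\<close>

context alternating_ode
begin

text \<open>Contains all periodic orbits off the lines, together with the periodic lines that may be
  double.\<close>

definition "Z = {p \<in> periodic_values S. integral {0..1} (\<lambda>t. R (flow p t) t) = 0}"

lemma periodic_flow:
  assumes "p \<in> periodic_values S"
  shows "solves S (flow p)" "flow p 0 = p" "flow p 1 = p"
proof -
  obtain x where x: "solves S x" "x 0 = p" "x 1 = p" using assms periodic_iff by blast
  have p: "p \<in> return_dom S" using solves_return_dom[OF x(1)] x(2) by simp
  show "solves S (flow p)" "flow p 0 = p" using flow[OF p] by auto
  show "flow p 1 = p" using flow_eq[OF x(1), of 1] x by simp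
qed

lemma periodic_flow_avoids_A:
  "p \<in> periodic_values S \<Longrightarrow> t \<in> {0..1} \<Longrightarrow> flow p t \<notin> A"
  using periodic_avoids_A periodic_flow by simp

text \<open>The bound is a sum of two indicators: a possibly double line is counted once as a line
  and once in \<open>Z\<close>.\<close>

lemma periodic_multiplicity:
  assumes p: "p \<in> periodic_values S" and nd: "A \<noteq> {} \<or> integral {0..1} (a m) \<noteq> 0"
  shows "p \<in> (L - A) \<union> Z"
    and "multiplicity_at S p \<le> enat (of_bool (p \<in> L - A) + of_bool (p \<in> Z))"
proof -
  note fl = periodic_flow[OF p]
  have closed: "flow p 0 = flow p 1" using fl by simp
  have "p \<in> (L - A) \<union> Z \<and> multiplicity_at S p \<le> enat (of_bool (p \<in> L - A) + of_bool (p \<in> Z))"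
  proof (cases "p \<in> L")
    case True
    then have pA: "p \<in> L - A" using periodic_flow_avoids_A[OF p, of 0] fl by auto
    have "flow p t = p" if "t \<in> {0..1}" for t
      using solution_meets_line(2)[OF fl(1) True, of 0] closed fl that by auto
    then have "integral {0..1} (\<lambda>t. R (flow p t) t) = integral {0..1} (\<lambda>t. R p t)"
      by (intro integral_cong) simp
    then have Z: "p \<in> Z \<longleftrightarrow> integral {0..1} (\<lambda>t. R p t) = 0" using p by (simp add: Z_def)
    show ?thesis
    proof (cases "p \<in> Z")
      case True
      \<comment> \<open>With \<open>A\<close> empty, \<open>R\<close> is just \<open>a m\<close>,
        whose integral would be nonzero by \<open>nd\<close>.\<close>
      have "A \<noteq> {}" using True Z nd by (auto simp: R_def)
      from line_multiplicity_2[OF this pA] show ?thesis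
        using True Z pA by (simp add: numeral_eq_enat numeral_2_eq_2)
    next
      case False
      then show ?thesis using line_multiplicity_1[OF pA] Z pA by (simp add: one_enat_def)
    qed
  next
    case False
    have off: "flow p t \<notin> L" if "t \<in> {0..1}" for t
      using solution_meets_line(2)[OF fl(1) _ that refl, of 0] closed fl(2) False by auto
    have "integral {0..1} (\<lambda>t. R (flow p t) t) = 0"
      using integral_R_off_lines[OF fl(1) off] fl by simp
    then have Z: "p \<in> Z" using p by (simp add: Z_def)
    have "A \<noteq> {}" using \<open>integral {0..1} (\<lambda>t. R (flow p t) t) = 0\<close> nd by (auto simp: R_def)
    from multiplicity_off_lines[OF this fl(1) closed off] show ?thesis
      using Z False fl by (simp add: one_enat_def)
  qed
  then show "p \<in> (L - A) \<union> Z"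
    "multiplicity_at S p \<le> enat (of_bool (p \<in> L - A) + of_bool (p \<in> Z))" by auto
qed

section \<open>Counting orbits with vanishing integral of \<open>R\<close> by gaps of
  \<open>A\<close>\<close>

lemma flow_side:
  assumes p: "p \<in> periodic_values S" and "\<nu> \<in> A" "t \<in> {0..1}"
  shows "\<nu> < flow p t \<longleftrightarrow> \<nu> < p"
proof -
  have "continuous_on {0..1} (\<lambda>t. flow p t - \<nu>)"
    by (intro continuous_on_diff continuous_on_const solves_continuous[OF periodic_flow(1)[OF p]])
  moreover have "flow p s - \<nu> \<noteq> 0" if "s \<in> {0..1}" for s
    using periodic_flow_avoids_A[OF p that] assms(2) by auto
  ultimately have "0 < flow p t - \<nu> \<longleftrightarrow> 0 < flow p 0 - \<nu>"
    using assms(3) by (intro const_sign) auto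
  then show ?thesis using periodic_flow(2)[OF p] by simp
qed

lemma Z_incomparable:
  assumes A: "A \<noteq> {}" and Z: "p \<in> Z" "q \<in> Z"
    and less: "\<And>\<nu> t. \<nu> \<in> A \<Longrightarrow> t \<in> {0..1} \<Longrightarrow> 1 / (flow q t - \<nu>) < 1 / (flow p t - \<nu>)"
  shows False
proof -
  have per: "p \<in> periodic_values S" "q \<in> periodic_values S" using Z by (auto simp: Z_def)
  have "integral {0..1} (\<lambda>t. R (flow p t) t) \<noteq> integral {0..1} (\<lambda>t. R (flow q t) t)"
    using solves_continuous[OF periodic_flow(1)[OF per(1)]] solves_continuous[OF periodic_flow(1)[OF per(2)]]
    by (intro R_strict_compare A periodic_flow_avoids_A per less)
  then show False using Z by (simp add: Z_def)
qed

text \<open>Encodes the gap of \<open>A\<close> that contains \<open>p\<close>; the values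
  \<open>{}\<close> and \<open>A\<close> are the two unbounded gaps.\<close>

definition "below p = {\<nu> \<in> A. \<nu> < p}"

text \<open>Orbits in one gap keep their order and stay on the same side of every pole, where
  \<open>1 / (x - \<nu>)\<close> is strictly decreasing.\<close>

lemma Z_separated:
  assumes A: "A \<noteq> {}" and Z: "p \<in> Z" "q \<in> Z" and "p < q"
  shows "below p \<noteq> below q"
proof
  assume eq: "below p = below q"
  have per: "p \<in> periodic_values S" "q \<in> periodic_values S" using Z by (auto simp: Z_def)
  show False
  proof (rule Z_incomparable[OF A Z])
    fix \<nu> t assume \<nu>: "\<nu> \<in> A" and t: "t \<in> {0..1::real}"
    have lt: "flow p t < flow q t"
      using solution_less[OF periodic_flow(1)[OF per(1)] periodic_flow(1)[OF per(2)] _ t]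
        periodic_flow(2) per \<open>p < q\<close> by simp
    have ne: "flow p t \<noteq> \<nu>" "flow q t \<noteq> \<nu>" using periodic_flow_avoids_A per \<nu> t by auto
    have "\<nu> < p \<longleftrightarrow> \<nu> < q" using eq \<nu> by (auto simp: below_def)
    then have "\<nu> < flow p t \<longleftrightarrow> \<nu> < flow q t" using flow_side per \<nu> t by simp
    then consider "0 < flow p t - \<nu>" | "flow q t - \<nu> < 0" using ne by argo
    then show "1 / (flow q t - \<nu>) < 1 / (flow p t - \<nu>)"
      using lt by cases (auto intro!: divide_strict_left_mono divide_strict_left_mono_neg
        mult_pos_pos mult_neg_neg simp: divide_simps)
  qed
qed

text \<open>To the left of all poles every \<open>1 / (x - \<nu>)\<close> is negative, to the right
  every one is positive, so the comparison of \<open>R\<close> applies across the poles.\<close>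

lemma Z_not_both_extremes:
  assumes A: "A \<noteq> {}" and Z: "p \<in> Z" "q \<in> Z"
  shows "\<not> (below p = {} \<and> below q = A)"
proof
  assume eq: "below p = {} \<and> below q = A"
  have per: "p \<in> periodic_values S" "q \<in> periodic_values S" using Z by (auto simp: Z_def)
  show False
  proof (rule Z_incomparable[OF A Z(2,1)])
    fix \<nu> t assume \<nu>: "\<nu> \<in> A" and t: "t \<in> {0..1::real}"
    have "flow p t \<noteq> \<nu>" using periodic_flow_avoids_A per \<nu> t by auto
    moreover have "\<not> \<nu> < p" "\<nu> < q" using eq \<nu> by (auto simp: below_def)
    ultimately have "flow p t - \<nu> < 0" "0 < flow q t - \<nu>"
      using flow_side[OF per(1) \<nu> t] flow_side[OF per(2) \<nu> t] by auto
    then show "1 / (flow p t - \<nu>) < 1 / (flow q t - \<nu>)"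
      using divide_neg_pos by (smt (verit) divide_neg_neg divide_pos_neg divide_pos_pos)
  qed
qed

lemma below_chain: "below p \<subseteq> below q \<or> below q \<subseteq> below p"
  by (auto simp: below_def)

lemma finite_Z_card:
  assumes nd: "A \<noteq> {} \<or> integral {0..1} (a m) \<noteq> 0"
  shows "finite Z \<and> card Z \<le> card A"
proof (cases "A = {}")
  case True
  then have "Z = {}" using nd by (auto simp: Z_def R_def)
  then show ?thesis by simp
next
  case False
  define N where "N p = card (below p)" for p
  have fb: "finite (below p)" for p using fin_A by (auto simp: below_def)
  \<comment> \<open>The sets \<open>below p\<close> form a chain, so their cardinality determines
    them and numbers the gaps from 0 to \<open>card A\<close>.\<close>
  have N_eq: "below p = below q" if "N p = N q" for p q
    using below_chain[of p q] that card_subset_eq[OF fb] unfolding N_def by metis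
  have inj: "inj_on N Z"
  proof (rule inj_onI)
    fix p q assume "p \<in> Z" "q \<in> Z" "N p = N q"
    then show "p = q" using Z_separated[OF False] N_eq by (metis linorder_cases)
  qed
  have bsub: "below p \<subseteq> A" for p by (auto simp: below_def)
  have N_le: "N p \<le> card A" for p unfolding N_def by (rule card_mono[OF fin_A bsub])
  have N0: "below p = {}" if "N p = 0" for p using that fb by (simp add: N_def)
  have NA: "below p = A" if "N p = card A" for p
    using that card_subset_eq[OF fin_A bsub] by (simp add: N_def)
  have fin_img: "finite (N ` Z)" by (rule finite_subset[of _ "{..card A}"]) (use N_le in auto)
  \<comment> \<open>Of the \<open>card A + 1\<close> gap numbers at least one is missed, namely 0 or
    \<open>card A\<close>, as the two unbounded gaps cannot both be occupied.\<close>
  have "\<exists>k\<in>{..card A}. N ` Z \<subseteq> {..card A} - {k}"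
  proof (cases "0 \<in> N ` Z")
    case True
    then have "card A \<notin> N ` Z" using Z_not_both_extremes[OF False] N0 NA by (metis imageE)
    then show ?thesis using N_le by (intro bexI[of _ "card A"]) force+
  next
    case False
    then show ?thesis using N_le by (intro bexI[of _ 0]) auto
  qed
  then obtain k where k: "k \<le> card A" "N ` Z \<subseteq> {..card A} - {k}" by auto
  have "card (N ` Z) \<le> card ({..card A} - {k})" by (rule card_mono[OF _ k(2)]) simp
  also have "\<dots> = card A" using k(1) by simp
  finally show ?thesis using inj fin_img by (simp add: card_image finite_image_iff)
qed

text \<open>Summing the two indicators gives \<open>card (L - A) + card Z\<close>, and
  \<open>card Z\<close> is at most \<open>card A\<close>.\<close>

lemma nondegenerate_bound:
  assumes nd: "A \<noteq> {} \<or> integral {0..1} (a m) \<noteq> 0"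
  shows "finite (periodic_values S)"
    and "I \<subseteq> periodic_values S \<Longrightarrow> (\<Sum>p\<in>I. multiplicity_at S p) \<le> enat (card L)"
proof -
  let ?W = "(L - A) \<union> Z"
  let ?f = "\<lambda>p. of_bool (p \<in> L - A) + of_bool (p \<in> Z) :: nat"
  have finW: "finite ?W" using fin finite_Z_card[OF nd] by auto
  have count: "(\<Sum>p\<in>?W. of_bool (p \<in> B)) = card (?W \<inter> B)" for B
    using finW by simp
  show finP: "finite (periodic_values S)"
    by (rule finite_subset[OF _ finW]) (use periodic_multiplicity(1)[OF _ nd] in blast)
  assume I: "I \<subseteq> periodic_values S"
  have "(\<Sum>p\<in>I. multiplicity_at S p) \<le> (\<Sum>p\<in>I. enat (?f p))"
    using periodic_multiplicity(2)[OF _ nd] I by (intro sum_mono) blast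
  also have "\<dots> = enat (\<Sum>p\<in>I. ?f p)"
    by (induct I rule: infinite_finite_induct) (auto simp: zero_enat_def)
  also have "(\<Sum>p\<in>I. ?f p) \<le> (\<Sum>p\<in>?W. ?f p)"
    using periodic_multiplicity(1)[OF _ nd] I by (intro sum_mono2 finW) auto
  also have "\<dots> = card (?W \<inter> (L - A)) + card (?W \<inter> Z)"
    by (simp only: sum.distrib count)
  also have "\<dots> = card (L - A) + card Z" by (simp add: Int_absorb1)
  also have "\<dots> \<le> card (L - A) + card A" using finite_Z_card[OF nd] by simp
  also have "\<dots> = card L" using card_Diff_subset[OF fin_A A_sub] card_mono[OF fin A_sub] by simp
  finally show "(\<Sum>p\<in>I. multiplicity_at S p) \<le> enat (card L)" by simp
qed

section \<open>The degenerate case\<close>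

lemma degenerate_all_periodic:
  assumes A: "A = {}" and z: "integral {0..1} (a m) = 0" and p: "p \<in> return_dom S"
  shows "p \<in> periodic_values S"
proof -
  let ?x = "flow p"
  note fl = flow[OF p]
  have xc: "continuous_on {0..1} ?x" by (rule solves_continuous[OF fl(1)])
  have "?x 1 = ?x 0"
  proof (cases "\<exists>t\<in>{0..1}. ?x t \<in> L")
    case True
    then obtain t where t: "t \<in> {0..1}" "?x t \<in> L" by blast
    have "?x s = ?x t" if "s \<in> {0..1}" for s
      by (rule solution_meets_line(2)[OF fl(1) t(2,1) refl _ that]) (simp add: A)
    then show ?thesis by simp
  next
    case False
    then have off: "\<And>t. t \<in> {0..1} \<Longrightarrow> ?x t \<notin> L" by blast
    have Y: "Y (?x 1) = Y (?x 0)"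
      using integral_R_off_lines[OF fl(1) off] A z by (simp add: R_def)
    have conn: "connected (?x ` {0..1})" by (intro connected_continuous_image xc) simp
    \<comment> \<open>The range of the orbit is an interval free of lines, where the derivative
      \<open>1 / P\<close> of \<open>Y\<close> never vanishes; by the mean value theorem
      \<open>Y\<close> is injective on it.\<close>
    have sep: False if uv: "u < v" "Y u = Y v" "u \<in> ?x ` {0..1}" "v \<in> ?x ` {0..1}" for u v
    proof -
      have sub: "{u..v} \<subseteq> ?x ` {0..1}" by (rule connected_contains_Icc[OF conn uv(3,4)])
      then have L: "y \<notin> L" if "u \<le> y" "y \<le> v" for y using off that 
      proof -
        have "y \<in> ?x ` {0..1}" using that sub by auto
        then show ?thesis using off by blast
      qed
      obtain y where y: "u < y" "y < v" "Y v - Y u = (v - u) * (1 / poly P y)"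
        using MVT2[OF uv(1), of Y "\<lambda>y. 1 / poly P y"] Y_has_derivative L by blast
      then show False using uv L[of y] by (simp add: poly_P_eq_0)
    qed
    show ?thesis using sep[of "?x 0" "?x 1"] sep[of "?x 1" "?x 0"] Y by force
  qed
  then show ?thesis using fl periodic_iff by auto
qed

text \<open>The periodic values fill the open set \<open>return_dom S\<close>, and an open set of
  reals has no isolated points.\<close>

lemma degenerate_no_isolated:
  assumes "A = {}" "integral {0..1} (a m) = 0"
  shows "isolated_periodic_values S = {}"
proof -
  have eq: "periodic_values S = return_dom S"
    using degenerate_all_periodic[OF assms] by (auto simp: periodic_values_def)
  have "\<not> p isolated_in return_dom S" for p
    unfolding isolated_in_def using return_dom_open open_Int not_open_singleton by metis
  then show ?thesis by (simp add: isolated_periodic_values_def eq)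
qed

lemma isolated_periodic_bound:
  "finite (isolated_periodic_values S) \<and>
    (\<Sum>p\<in>isolated_periodic_values S. multiplicity_at S p) \<le> enat (card L)"
proof (cases "A \<noteq> {} \<or> integral {0..1} (a m) \<noteq> 0")
  case True
  have "isolated_periodic_values S \<subseteq> periodic_values S"
    by (auto simp: isolated_periodic_values_def isolated_in_def)
  then show ?thesis using nondegenerate_bound[OF True] finite_subset by blast
next
  case False
  then show ?thesis using degenerate_no_isolated by simp
qed

end

section \<open>Alternating lines and sharpness\<close>

text \<open>Exactly the \<open>m - i\<close> factors belonging to lines above \<open>l i\<close> are
  negative.\<close>

lemma node_weight_sign:
  fixes l :: "nat \<Rightarrow> real"
  assumes mono: "strict_mono_on {1..m} l" and i: "i \<in> {1..m}"
  shows "0 < (- 1) ^ (m - i) * (\<Prod>\<mu>\<in>l ` {1..m} - {l i}. l i - \<mu>)"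
proof -
  have less: "l j < l k" if "j < k" "j \<in> {1..m}" "k \<in> {1..m}" for j k
    using strict_mono_onD[OF mono] that by blast
  have inj: "inj_on l {1..m}" by (rule strict_mono_on_imp_inj_on[OF mono])
  have "l ` {1..m} - {l i} = l ` ({1..m} - {i})"
    using inj_on_image_set_diff[OF inj, of "{1..m}" "{i}"] i by simp
  also have "{1..m} - {i} = {1..<i} \<union> {i<..m}" using i by auto
  finally have img: "l ` {1..m} - {l i} = l ` ({1..<i} \<union> {i<..m})" .
  have "(\<Prod>\<mu>\<in>l ` {1..m} - {l i}. l i - \<mu>) = (\<Prod>j\<in>{1..<i} \<union> {i<..m}. l i - l j)"
    unfolding img by (subst prod.reindex) (use i in \<open>auto intro: inj_on_subset[OF inj]\<close>)
  also have "\<dots> = (\<Prod>j\<in>{1..<i}. l i - l j) * (\<Prod>j\<in>{i<..m}. l i - l j)"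
    by (rule prod.union_disjoint) auto
  also have "(\<Prod>j\<in>{i<..m}. l i - l j) = (- 1) ^ (m - i) * (\<Prod>j\<in>{i<..m}. l j - l i)"
    by (subst prod_diff_swap) simp
  finally have "(- 1) ^ (m - i) * (\<Prod>\<mu>\<in>l ` {1..m} - {l i}. l i - \<mu>) =
      ((- 1) ^ (m - i) * (- 1) ^ (m - i)) * ((\<Prod>j\<in>{1..<i}. l i - l j) * (\<Prod>j\<in>{i<..m}. l j - l i))"
    by (simp only: mult_ac)
  also have "\<dots> = (\<Prod>j\<in>{1..<i}. l i - l j) * (\<Prod>j\<in>{i<..m}. l j - l i)"
    by (simp flip: power_mult_distrib)
  also have "\<dots> > 0"
    by (intro mult_pos_pos prod_pos) (use i less in auto)
  finally show ?thesis .
qed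

lemma smooth_on_unit_continuous:
  assumes "smooth_on_unit f" shows "continuous_on {0..1} f"
proof -
  obtain D where D: "\<forall>t\<in>{0..1}. D 0 t = f t"
    "\<And>t. t \<in> {0..1} \<Longrightarrow> (D 0 has_real_derivative D (Suc 0) t) (at t within {0..1})"
    using assms unfolding smooth_on_unit_def by blast
  have "continuous_on {0..1} (D 0)"
    using D(2) DERIV_continuous by (force simp: continuous_on_eq_continuous_within)
  then show ?thesis by (rule continuous_on_eq) (use D(1) in blast)
qed

lemma smooth_on_unit_const: "smooth_on_unit (\<lambda>_. k)"
  unfolding smooth_on_unit_def by (rule exI[of _ "\<lambda>n _. if n = 0 then k else 0"]) auto

lemma alternating_ode_of_lines:
  assumes "m \<ge> 1" and sm: "\<And>i. i \<le> m \<Longrightarrow> smooth_on_unit (a i)"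
    and mono: "strict_mono_on {1..m} l" and s: "s = 1 \<or> s = (- 1 :: real)"
    and sign: "\<And>t i. t \<in> {0..1} \<Longrightarrow> i \<in> {1..m} \<Longrightarrow> 0 \<le> s * ((- 1) ^ i * poly_field m a (l i) t)"
  shows "alternating_ode m a (l ` {1..m})
    (\<lambda>\<nu> t. poly_field m a \<nu> t / (\<Prod>\<mu>\<in>l ` {1..m} - {\<nu>}. \<nu> - \<mu>)) (s * (- 1) ^ m)"
proof -
  let ?L = "l ` {1..m}"
  interpret poly_ode m a using sm smooth_on_unit_continuous by unfold_locales auto
  have inj: "inj_on l {1..m}" by (rule strict_mono_on_imp_inj_on[OF mono])
  then have card: "card ?L = m" by (simp add: card_image)
  show ?thesis
  proof
    show "continuous_on {0..1} (\<lambda>t. S \<nu> t / (\<Prod>\<mu>\<in>?L - {\<nu>}. \<nu> - \<mu>))" for \<nu>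
      by (intro continuous_intros continuous_on_field) auto
    fix t :: real assume t: "t \<in> {0..1}"
    show "0 \<le> s * (- 1) ^ m * (S \<nu> t / (\<Prod>\<mu>\<in>?L - {\<nu>}. \<nu> - \<mu>))" if \<nu>: "\<nu> \<in> ?L" for \<nu>
    proof -
      obtain i where i: "i \<in> {1..m}" "\<nu> = l i" using \<nu> by auto
      let ?w = "\<Prod>\<mu>\<in>?L - {\<nu>}. \<nu> - \<mu>"
      have w: "0 < (- 1) ^ (m - i) * ?w" using node_weight_sign[OF mono i(1)] i(2) by simp
      \<comment> \<open>The alternating sign at index \<open>i\<close> and the sign of the node
        weight combine to one that is independent of \<open>i\<close>.\<close>
      have "(- 1 :: real) ^ m = (- 1) ^ i * (- 1) ^ (m - i)" using i(1) by (simp flip: power_add)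
      moreover have "(- 1 :: real) ^ (m - i) / ((- 1) ^ (m - i) * (- 1) ^ (m - i)) = (- 1) ^ (m - i)"
        by (simp flip: power_mult_distrib)
      ultimately have "s * (- 1) ^ m * (S \<nu> t / ?w) = s * ((- 1) ^ i * S \<nu> t) / ((- 1) ^ (m - i) * ?w)"
        by (simp add: field_simps)
      also have "\<dots> \<ge> 0" using sign[OF t i(1)] i(2) w by (intro divide_nonneg_pos) auto
      finally show ?thesis .
    qed
    fix x
    define p where "p = (\<Sum>i\<le>m. monom (a i t) i)"
    have p: "poly p y = S y t" for y by (simp add: p_def poly_sum poly_monom poly_field_def)
    have "degree p \<le> m" unfolding p_def
      by (intro degree_sum_le) (auto intro: order_trans[OF degree_monom_le])
    moreover have "coeff p m = a m t" by (simp add: p_def coeff_sum)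
    ultimately show "S x t = a m t * (\<Prod>\<mu>\<in>?L. x - \<mu>) +
        (\<Sum>\<nu>\<in>?L. S \<nu> t / (\<Prod>\<mu>\<in>?L - {\<nu>}. \<nu> - \<mu>) * (\<Prod>\<mu>\<in>?L - {\<nu>}. x - \<mu>))"
      using lagrange_expansion[of ?L p x] card p by simp
  qed (use \<open>m \<ge> 1\<close> s in auto)
qed

section \<open>Sharpness\<close>

text \<open>The autonomous equation whose right-hand side is the monic polynomial with roots
  \<open>1, ..., m\<close>. All lines are solutions, so \<open>A\<close> is empty;
  \<open>a m = 1\<close> makes it nondegenerate and \<open>Z\<close> empty, so the lines are the
  only periodic orbits and each is simple.\<close>

lemma sharp_example:
  assumes "m \<ge> 1"
  defines "a \<equiv> \<lambda>i (_::real). coeff (\<Prod>k\<in>{1..m}. [:- real k, 1:]) i"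
  shows "(\<forall>i\<le>m. smooth_on_unit (a i)) \<and> alternating_lines m (poly_field m a) \<and>
    finite (isolated_periodic_values (poly_field m a)) \<and>
    (\<Sum>x0\<in>isolated_periodic_values (poly_field m a). multiplicity_at (poly_field m a) x0) = enat m"
proof -
  define q where "q = (\<Prod>k\<in>{1..m}. [:- real k, 1:])"
  define L where "L = real ` {1..m}"
  have card: "card L = m" by (simp add: L_def card_image)
  have deg: "degree q = m" unfolding q_def by (subst degree_prod_eq_sum_degree) auto
  have "lead_coeff q = 1" unfolding q_def lead_coeff_prod by simp
  then have am: "a m t = 1" for t using deg by (simp add: a_def q_def)
  have field: "poly_field m a x t = (\<Prod>\<mu>\<in>L. x - \<mu>)" for x t
  proof -
    have "poly_field m a x t = poly q x" 
      unfolding poly_altdef deg by (simp add: poly_field_def a_def q_def)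
    also have "\<dots> = (\<Prod>\<mu>\<in>L. x - \<mu>)" by (simp add: q_def L_def poly_prod prod.reindex)
    finally show ?thesis .
  qed
  interpret alternating_ode m a L "\<lambda>_ _. 0" 1
  proof
    show "continuous_on {0..1} (a i)" for i by (simp add: a_def)
  qed (use assms(1) in \<open>auto simp: field am L_def\<close>)
  have A: "A = {}" unfolding A_def by simp
  have nd: "A \<noteq> {} \<or> integral {0..1} (a m) \<noteq> 0"
    using am by (simp cong: integral_cong)
  have Z: "Z = {}" using finite_Z_card[OF nd] A by auto
  have per: "periodic_values S = L"
  proof
    show "periodic_values S \<subseteq> L" using periodic_multiplicity(1)[OF _ nd] Z by blast
    show "L \<subseteq> periodic_values S" using line_solution A periodic_iff by fastforce
  qed
  have iso: "isolated_periodic_values S = L"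
    unfolding isolated_periodic_values_def isolated_in_islimpt_iff per
    using islimpt_finite[of L] by (auto simp: L_def)
  have mult: "multiplicity_at S p = 1" if "p \<in> L" for p
  proof (rule antisym)
    show "multiplicity_at S p \<le> 1"
      using periodic_multiplicity(2)[OF _ nd, of p] that per A Z by (simp add: one_enat_def)
    show "1 \<le> multiplicity_at S p" using multiplicity_ge_1 that per by blast
  qed
  have "(\<Sum>x0\<in>isolated_periodic_values S. multiplicity_at S x0) = (\<Sum>x0\<in>L. 1)"
    unfolding iso by (intro sum.cong mult) auto
  also have "\<dots> = enat m" by (simp add: card of_nat_eq_enat)
  finally have sum: "(\<Sum>x0\<in>isolated_periodic_values S. multiplicity_at S x0) = enat m" .
  have zero: "S (real i) t = 0" if "i \<in> {1..m}" for i t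
    using that by (auto simp: field L_def)
  have "alternating_lines m S"
    unfolding alternating_lines_def
    by (rule exI[of _ real]) (use zero in \<open>simp add: strict_mono_on_def\<close>)
  moreover have "\<forall>i\<le>m. smooth_on_unit (a i)" by (simp add: a_def smooth_on_unit_const)
  ultimately show ?thesis using sum iso by (simp add: L_def)
qed

theorem theorem1p1:
  fixes m :: nat
  assumes "m \<ge> 1"
  shows "(\<forall>a :: nat \<Rightarrow> real \<Rightarrow> real.
            (\<forall>i\<le>m. smooth_on_unit (a i)) \<and> alternating_lines m (poly_field m a) \<longrightarrow>
            finite (isolated_periodic_values (poly_field m a)) \<and>
            (\<Sum>x0\<in>isolated_periodic_values (poly_field m a).
               multiplicity_at (poly_field m a) x0) \<le> enat m) \<and>
         (\<exists>a :: nat \<Rightarrow> real \<Rightarrow> real.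
            (\<forall>i\<le>m. smooth_on_unit (a i)) \<and> alternating_lines m (poly_field m a) \<and>
            finite (isolated_periodic_values (poly_field m a)) \<and>
            (\<Sum>x0\<in>isolated_periodic_values (poly_field m a).
               multiplicity_at (poly_field m a) x0) = enat m)"
proof (rule conjI; (intro allI impI; elim conjE)?)
  fix a :: "nat \<Rightarrow> real \<Rightarrow> real"
  assume sm: "\<forall>i\<le>m. smooth_on_unit (a i)" and alt: "alternating_lines m (poly_field m a)"
  obtain l where l: "strict_mono_on {1..m} l"
    and sgn: "(\<forall>t\<in>{0..1}. \<forall>i\<in>{1..m}. (- 1) ^ i * poly_field m a (l i) t \<ge> 0) \<or>
      (\<forall>t\<in>{0..1}. \<forall>i\<in>{1..m}. (- 1) ^ i * poly_field m a (l i) t \<le> 0)"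
    using alt unfolding alternating_lines_def by blast
  \<comment> \<open>The sign \<open>s\<close> merges the two alternatives of the alternation
    hypothesis.\<close>
  obtain s :: real where s: "s = 1 \<or> s = - 1"
    "\<And>t i. t \<in> {0..1} \<Longrightarrow> i \<in> {1..m} \<Longrightarrow> 0 \<le> s * ((- 1) ^ i * poly_field m a (l i) t)"
  proof (cases "\<forall>t\<in>{0..1}. \<forall>i\<in>{1..m}. (- 1) ^ i * poly_field m a (l i) t \<ge> 0")
    case True
    then show ?thesis by (intro that[of 1]) auto
  next
    case False
    with sgn have "\<forall>t\<in>{0..1}. \<forall>i\<in>{1..m}. (- 1) ^ i * poly_field m a (l i) t \<le> 0" by blast
    then show ?thesis by (intro that[of "- 1"]) auto
  qed
  interpret alternating_ode m a "l ` {1..m}"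
    "\<lambda>\<nu> t. poly_field m a \<nu> t / (\<Prod>\<mu>\<in>l ` {1..m} - {\<nu>}. \<nu> - \<mu>)" "s * (- 1) ^ m"
    by (rule alternating_ode_of_lines[OF assms _ l s]) (use sm in blast)+
  have "card (l ` {1..m}) = m"
    using strict_mono_on_imp_inj_on[OF l] by (simp add: card_image)
  then show "finite (isolated_periodic_values (poly_field m a)) \<and>
      (\<Sum>x0\<in>isolated_periodic_values (poly_field m a).
         multiplicity_at (poly_field m a) x0) \<le> enat m"
    using isolated_periodic_bound by simp
next
  show "\<exists>a :: nat \<Rightarrow> real \<Rightarrow> real.
      (\<forall>i\<le>m. smooth_on_unit (a i)) \<and> alternating_lines m (poly_field m a) \<and>
      finite (isolated_periodic_values (poly_field m a)) \<and>
      (\<Sum>x0\<in>isolated_periodic_values (poly_field m a).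
         multiplicity_at (poly_field m a) x0) = enat m"
    by (rule exI, rule sharp_example[OF assms])
qed

end
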